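(* Let $\mathcal{C}$ be a dg category over a commutative ring $\Bbbk$, and let $f_0\in\operatorname{Hom}^0_{\mathcal{C}}(X,Y)$, $g_0\in\operatorname{Hom}^0_{\mathcal{C}}(Y,X)$, $h_0\in\operatorname{End}^{-1}_{\mathcal{C}}(X)$, $k_0\in\operatorname{End}^{-1}_{\mathcal{C}}(Y)$ be the data of a homotopy equivalence $X\simeq Y$, i.e. $d(f_0)=d(g_0)=0$, $d(h_0)=\operatorname{id}_X-g_0f_0$, $d(k_0)=\operatorname{id}_Y-f_0g_0$. Then, possibly after modification of $h_0$ or $k_0$, these data lift to a strong homotopy equivalence: there exists a strong homotopy equivalence $f(\epsilon),g(\epsilon),h(\epsilon),k(\epsilon)$ relating $X$ and $Y$ in $\mathcal{C}$ whose $\epsilon^0$-coefficients satisfy $f(0)=f_0$, $g(0)=g_0$, and at least one of $h(0)=h_0$, $k(0)=k_0$.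
   Context: Dg categories are $\Bbbk$-linear, with $\mathbb{Z}$-graded hom complexes, differential $d$ of degree $+1$, and Leibniz rule $d(f\circ g)=d(f)\circ g+(-1)^{|f|}f\circ d(g)$. $\mathcal{C}[[\epsilon]]$: here $\epsilon$ is a formal variable of degree $2$. $\mathcal{C}[[\epsilon]]$ has the same objects as $\mathcal{C}$; a degree $l$ morphism $X\to Y$ is a formal series $\sum_{i\ge0}f_i\epsilon^i$ with $f_i\in\operatorname{Hom}^{l-2i}_{\mathcal{C}}(X,Y)$; composition and differential are $\epsilon$-linear. Strong homotopy equivalence: a strong homotopy equivalence $X\simeq Y$ in $\mathcal{C}$ consists of morphisms in $\mathcal{C}[[\epsilon]]$: $f(\epsilon):X\to Y$, $g(\epsilon):Y\to X$ of degree $0$, and $h(\epsilon):X\to X$, $k(\epsilon):Y\to Y$ of degree $-1$, such that (writing $f=f(\epsilon)$, etc.) \[ d(f)=\epsilon(fh-kf),\quad d(g)=\epsilon(gk-hg),\quad d(h)=\operatorname{id}_X-gf-\epsilon h^2,\quad d(k)=\operatorname{id}_Y-fg-\epsilon k^2 . \] Setting $\epsilon=0$ in such data gives the data of an ordinary homotopy equivalence. *)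

theory Defs
  imports "HOL-Algebra.Module"
begin

text \<open>
  The hom complexes of a dg category are given degreewise: \<open>Hom C X Y n\<close> is the module of
  morphisms of degree \<open>n\<close>. Different hom modules need not be disjoint in the carrier
  type \<open>'m\<close>, so composition and differential take the objects and degrees involved as arguments:
  \<open>Comp C X Y Z m n g f\<close> is \<open>g \<circ> f\<close> for \<open>g : Y \<rightarrow> Z\<close> of degree \<open>m\<close> and \<open>f : X \<rightarrow> Y\<close> of
  degree \<open>n\<close>, and \<open>Diff C X Y n f\<close> is \<open>d f\<close> for \<open>f : X \<rightarrow> Y\<close> of degree \<open>n\<close>.
  The ring fields \<open>mult\<close> and \<open>one\<close> of the module records \<open>Hom C X Y n\<close> carry no meaning.
\<close>

record ('o, 'k, 'm) dgcat =
  Ob :: "'o set"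
  Hom :: "'o \<Rightarrow> 'o \<Rightarrow> int \<Rightarrow> ('k, 'm) module"
  Comp :: "'o \<Rightarrow> 'o \<Rightarrow> 'o \<Rightarrow> int \<Rightarrow> int \<Rightarrow> 'm \<Rightarrow> 'm \<Rightarrow> 'm"
  Ident :: "'o \<Rightarrow> 'm"
  Diff :: "'o \<Rightarrow> 'o \<Rightarrow> int \<Rightarrow> 'm \<Rightarrow> 'm"

definition koszul_sign :: "('m, 'a) ring_scheme \<Rightarrow> int \<Rightarrow> 'm \<Rightarrow> 'm" where
  "koszul_sign M n x = (if even n then x else \<ominus>\<^bsub>M\<^esub> x)"

locale dg_category = cring R for R (structure) +
  fixes C :: "('o, 'k, 'm) dgcat"
  assumes Hom_module:
      "\<lbrakk>X \<in> Ob C; Y \<in> Ob C\<rbrakk> \<Longrightarrow> module R (Hom C X Y n)"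
    and Comp_closed:
      "\<lbrakk>X \<in> Ob C; Y \<in> Ob C; Z \<in> Ob C;
        g \<in> carrier (Hom C Y Z m); f \<in> carrier (Hom C X Y n)\<rbrakk>
       \<Longrightarrow> Comp C X Y Z m n g f \<in> carrier (Hom C X Z (m + n))"
    and Comp_add_left:
      "\<lbrakk>X \<in> Ob C; Y \<in> Ob C; Z \<in> Ob C; g \<in> carrier (Hom C Y Z m);
        g' \<in> carrier (Hom C Y Z m); f \<in> carrier (Hom C X Y n)\<rbrakk>
       \<Longrightarrow> Comp C X Y Z m n (g \<oplus>\<^bsub>Hom C Y Z m\<^esub> g') f
           = Comp C X Y Z m n g f \<oplus>\<^bsub>Hom C X Z (m + n)\<^esub> Comp C X Y Z m n g' f"
    and Comp_add_right:
      "\<lbrakk>X \<in> Ob C; Y \<in> Ob C; Z \<in> Ob C; g \<in> carrier (Hom C Y Z m);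
        f \<in> carrier (Hom C X Y n); f' \<in> carrier (Hom C X Y n)\<rbrakk>
       \<Longrightarrow> Comp C X Y Z m n g (f \<oplus>\<^bsub>Hom C X Y n\<^esub> f')
           = Comp C X Y Z m n g f \<oplus>\<^bsub>Hom C X Z (m + n)\<^esub> Comp C X Y Z m n g f'"
    and Comp_smult_left:
      "\<lbrakk>X \<in> Ob C; Y \<in> Ob C; Z \<in> Ob C; a \<in> carrier R;
        g \<in> carrier (Hom C Y Z m); f \<in> carrier (Hom C X Y n)\<rbrakk>
       \<Longrightarrow> Comp C X Y Z m n (a \<odot>\<^bsub>Hom C Y Z m\<^esub> g) f
           = a \<odot>\<^bsub>Hom C X Z (m + n)\<^esub> Comp C X Y Z m n g f"
    and Comp_smult_right:
      "\<lbrakk>X \<in> Ob C; Y \<in> Ob C; Z \<in> Ob C; a \<in> carrier R;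
        g \<in> carrier (Hom C Y Z m); f \<in> carrier (Hom C X Y n)\<rbrakk>
       \<Longrightarrow> Comp C X Y Z m n g (a \<odot>\<^bsub>Hom C X Y n\<^esub> f)
           = a \<odot>\<^bsub>Hom C X Z (m + n)\<^esub> Comp C X Y Z m n g f"
    and Comp_assoc:
      "\<lbrakk>W \<in> Ob C; X \<in> Ob C; Y \<in> Ob C; Z \<in> Ob C; u \<in> carrier (Hom C Y Z l);
        v \<in> carrier (Hom C X Y m); w \<in> carrier (Hom C W X n)\<rbrakk>
       \<Longrightarrow> Comp C W X Z (l + m) n (Comp C X Y Z l m u v) w
           = Comp C W Y Z l (m + n) u (Comp C W X Y m n v w)"
    and Ident_closed:
      "X \<in> Ob C \<Longrightarrow> Ident C X \<in> carrier (Hom C X X 0)"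
    and Comp_Ident_left:
      "\<lbrakk>X \<in> Ob C; Y \<in> Ob C; f \<in> carrier (Hom C X Y n)\<rbrakk>
       \<Longrightarrow> Comp C X Y Y 0 n (Ident C Y) f = f"
    and Comp_Ident_right:
      "\<lbrakk>X \<in> Ob C; Y \<in> Ob C; f \<in> carrier (Hom C X Y n)\<rbrakk>
       \<Longrightarrow> Comp C X X Y n 0 f (Ident C X) = f"
    and Diff_closed:
      "\<lbrakk>X \<in> Ob C; Y \<in> Ob C; f \<in> carrier (Hom C X Y n)\<rbrakk>
       \<Longrightarrow> Diff C X Y n f \<in> carrier (Hom C X Y (n + 1))"
    and Diff_add:
      "\<lbrakk>X \<in> Ob C; Y \<in> Ob C; f \<in> carrier (Hom C X Y n); f' \<in> carrier (Hom C X Y n)\<rbrakk>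
       \<Longrightarrow> Diff C X Y n (f \<oplus>\<^bsub>Hom C X Y n\<^esub> f')
           = Diff C X Y n f \<oplus>\<^bsub>Hom C X Y (n + 1)\<^esub> Diff C X Y n f'"
    and Diff_smult:
      "\<lbrakk>X \<in> Ob C; Y \<in> Ob C; a \<in> carrier R; f \<in> carrier (Hom C X Y n)\<rbrakk>
       \<Longrightarrow> Diff C X Y n (a \<odot>\<^bsub>Hom C X Y n\<^esub> f) = a \<odot>\<^bsub>Hom C X Y (n + 1)\<^esub> Diff C X Y n f"
    and Diff_Diff:
      "\<lbrakk>X \<in> Ob C; Y \<in> Ob C; f \<in> carrier (Hom C X Y n)\<rbrakk>
       \<Longrightarrow> Diff C X Y (n + 1) (Diff C X Y n f) = \<zero>\<^bsub>Hom C X Y (n + 2)\<^esub>"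
    and Leibniz:
      "\<lbrakk>X \<in> Ob C; Y \<in> Ob C; Z \<in> Ob C;
        g \<in> carrier (Hom C Y Z m); f \<in> carrier (Hom C X Y n)\<rbrakk>
       \<Longrightarrow> Diff C X Z (m + n) (Comp C X Y Z m n g f)
           = Comp C X Y Z (m + 1) n (Diff C Y Z m g) f
             \<oplus>\<^bsub>Hom C X Z (m + n + 1)\<^esub>
             koszul_sign (Hom C X Z (m + n + 1)) m (Comp C X Y Z m (n + 1) g (Diff C X Y n f))"

definition homotopy_equivalence ::
  "('o, 'k, 'm) dgcat \<Rightarrow> 'o \<Rightarrow> 'o \<Rightarrow> 'm \<Rightarrow> 'm \<Rightarrow> 'm \<Rightarrow> 'm \<Rightarrow> bool" where
  "homotopy_equivalence C X Y f g h k \<longleftrightarrow>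
     f \<in> carrier (Hom C X Y 0) \<and> g \<in> carrier (Hom C Y X 0) \<and>
     h \<in> carrier (Hom C X X (-1)) \<and> k \<in> carrier (Hom C Y Y (-1)) \<and>
     Diff C X Y 0 f = \<zero>\<^bsub>Hom C X Y 1\<^esub> \<and>
     Diff C Y X 0 g = \<zero>\<^bsub>Hom C Y X 1\<^esub> \<and>
     Diff C X X (-1) h = Ident C X \<ominus>\<^bsub>Hom C X X 0\<^esub> Comp C X Y X 0 0 g f \<and>
     Diff C Y Y (-1) k = Ident C Y \<ominus>\<^bsub>Hom C Y Y 0\<^esub> Comp C Y X Y 0 0 f g"

text \<open>
  The dg category \<open>C[[\<epsilon>]]\<close>, with \<open>\<epsilon>\<close> of degree 2: the series \<open>\<Sum>i\<ge>0. f\<^sub>i \<epsilon>\<^sup>i\<close> is the function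
  \<open>i \<mapsto> f\<^sub>i\<close>. Since \<open>\<epsilon>\<close> is even, no signs appear when it is moved past morphisms or \<open>d\<close>.
\<close>

definition eps_Hom :: "('o, 'k, 'm) dgcat \<Rightarrow> 'o \<Rightarrow> 'o \<Rightarrow> int \<Rightarrow> ('k, nat \<Rightarrow> 'm) module" where
  "eps_Hom C X Y l =
     \<lparr>carrier = {f. \<forall>i. f i \<in> carrier (Hom C X Y (l - 2 * int i))},
      mult = undefined,
      one = undefined,
      zero = (\<lambda>i. \<zero>\<^bsub>Hom C X Y (l - 2 * int i)\<^esub>),
      add = (\<lambda>f g i. f i \<oplus>\<^bsub>Hom C X Y (l - 2 * int i)\<^esub> g i),
      smult = (\<lambda>a f i. a \<odot>\<^bsub>Hom C X Y (l - 2 * int i)\<^esub> f i)\<rparr>"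

definition eps_category :: "('o, 'k, 'm) dgcat \<Rightarrow> ('o, 'k, nat \<Rightarrow> 'm) dgcat" where
  "eps_category C =
     \<lparr>Ob = Ob C,
      Hom = eps_Hom C,
      Comp = (\<lambda>X Y Z m n g f i.
        \<Oplus>\<^bsub>Hom C X Z (m + n - 2 * int i)\<^esub> j \<in> {..i}.
          Comp C X Y Z (m - 2 * int j) (n - 2 * int (i - j)) (g j) (f (i - j))),
      Ident = (\<lambda>X i. if i = 0 then Ident C X else \<zero>\<^bsub>Hom C X X (- 2 * int i)\<^esub>),
      Diff = (\<lambda>X Y l f i. Diff C X Y (l - 2 * int i) (f i))\<rparr>"

text \<open>
  Multiplication by \<open>\<epsilon>\<close>, from degree \<open>l\<close> to degree \<open>l + 2\<close>; its coefficient of \<open>\<epsilon>\<^sup>0\<close> is zero.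
\<close>

definition eps_mult ::
  "('o, 'k, 'm) dgcat \<Rightarrow> 'o \<Rightarrow> 'o \<Rightarrow> int \<Rightarrow> (nat \<Rightarrow> 'm) \<Rightarrow> (nat \<Rightarrow> 'm)" where
  "eps_mult C X Y l f = (\<lambda>i. case i of 0 \<Rightarrow> \<zero>\<^bsub>Hom C X Y (l + 2)\<^esub> | Suc j \<Rightarrow> f j)"

definition strong_homotopy_equivalence ::
  "('o, 'k, 'm) dgcat \<Rightarrow> 'o \<Rightarrow> 'o \<Rightarrow>
    (nat \<Rightarrow> 'm) \<Rightarrow> (nat \<Rightarrow> 'm) \<Rightarrow> (nat \<Rightarrow> 'm) \<Rightarrow> (nat \<Rightarrow> 'm) \<Rightarrow> bool" where
  "strong_homotopy_equivalence C X Y f g h k \<longleftrightarrow>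
     (let E = eps_category C in
       f \<in> carrier (Hom E X Y 0) \<and> g \<in> carrier (Hom E Y X 0) \<and>
       h \<in> carrier (Hom E X X (-1)) \<and> k \<in> carrier (Hom E Y Y (-1)) \<and>
       Diff E X Y 0 f =
         eps_mult C X Y (-1)
           (Comp E X X Y 0 (-1) f h \<ominus>\<^bsub>Hom E X Y (-1)\<^esub> Comp E X Y Y (-1) 0 k f) \<and>
       Diff E Y X 0 g =
         eps_mult C Y X (-1)
           (Comp E Y Y X 0 (-1) g k \<ominus>\<^bsub>Hom E Y X (-1)\<^esub> Comp E Y X X (-1) 0 h g) \<and>
       Diff E X X (-1) h =
         Ident E X \<ominus>\<^bsub>Hom E X X 0\<^esub> Comp E X Y X 0 0 g f
           \<ominus>\<^bsub>Hom E X X 0\<^esub> eps_mult C X X (-2) (Comp E X X X (-1) (-1) h h) \<and>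
       Diff E Y Y (-1) k =
         Ident E Y \<ominus>\<^bsub>Hom E Y Y 0\<^esub> Comp E Y X Y 0 0 f g
           \<ominus>\<^bsub>Hom E Y Y 0\<^esub> eps_mult C Y Y (-2) (Comp E Y Y Y (-1) (-1) k k))"

end

theory Submission
  imports Defs
begin

text \<open>
  Up to replacing \<open>k\<^sub>0\<close>, the data of a homotopy equivalence provide a degree \<open>-1\<close> endomorphism \<open>s\<close> of
  the cone of \<open>g\<^sub>0\<close> with \<open>D s = 1\<close>, where \<open>D\<close> is the differential of the endomorphism algebra of
  the cone: as a matrix, \<open>s\<close> has first row \<open>(h\<^sub>0, w)\<close> and second row \<open>(f\<^sub>0, -k\<^sub>0)\<close>, and \<open>w\<close> becomes
  the coefficient of \<open>\<epsilon>\<close> in \<open>g(\<epsilon>)\<close>.  The equations of a strong homotopy equivalence say that the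
  matrix \<open>S\<close> with rows \<open>(\<epsilon>h(\<epsilon>), g(\<epsilon>) - g\<^sub>0)\<close> and \<open>(\<epsilon>f(\<epsilon>), -\<epsilon>k(\<epsilon>))\<close> satisfies
  \<open>D S + S\<^sup>2 = \<epsilon>\<close>.  As \<open>D\<close> sends the odd power \<open>s\<^sup>2\<^sup>n\<^sup>+\<^sup>1\<close> to \<open>s\<^sup>2\<^sup>n\<close>, a solution is
  \<open>S = \<Sum>n. e\<^sub>n \<epsilon>\<^sup>n\<^sup>+\<^sup>1 s\<^sup>2\<^sup>n\<^sup>+\<^sup>1\<close> with \<open>e\<^sub>0 = 1\<close> and \<open>e\<^sub>n\<^sub>+\<^sub>1 = - (\<Sum>i\<le>n. e\<^sub>i e\<^sub>n\<^sub>-\<^sub>i)\<close>, that is,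
  \<open>e\<^sub>n\<close> is \<open>(-1)\<^sup>n\<close> times the \<open>n\<close>-th Catalan number.
\<close>

section \<open>Morphisms with source, target and degree\<close>

text \<open>
  Storing the boundary data in the elements removes the object and degree arguments from all
  operations, and the side conditions of their laws become computations for the simplifier.
  The sum of two arrows takes its boundary from the first one.
\<close>

datatype ('o, 'm) arrow = Arrow (src: 'o) (tgt: 'o) (deg: int) (val: 'm)

context dg_category
begin

definition arr :: "('o, 'm) arrow \<Rightarrow> bool" where
  "arr x \<longleftrightarrow> src x \<in> Ob C \<and> tgt x \<in> Ob C \<and> val x \<in> carrier (Hom C (src x) (tgt x) (deg x))"

definition cmp :: "('o, 'm) arrow \<Rightarrow> ('o, 'm) arrow \<Rightarrow> ('o, 'm) arrow" (infixr "\<cdot>" 70) where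
  "x \<cdot> y = Arrow (src y) (tgt x) (deg x + deg y)
     (Comp C (src y) (tgt y) (tgt x) (deg x) (deg y) (val x) (val y))"

definition plus :: "('o, 'm) arrow \<Rightarrow> ('o, 'm) arrow \<Rightarrow> ('o, 'm) arrow" (infixr "\<boxplus>" 65) where
  "x \<boxplus> y = Arrow (src x) (tgt x) (deg x) (val x \<oplus>\<^bsub>Hom C (src x) (tgt x) (deg x)\<^esub> val y)"

definition neg :: "('o, 'm) arrow \<Rightarrow> ('o, 'm) arrow" where
  "neg x = Arrow (src x) (tgt x) (deg x) (\<ominus>\<^bsub>Hom C (src x) (tgt x) (deg x)\<^esub> val x)"

definition nul :: "'o \<Rightarrow> 'o \<Rightarrow> int \<Rightarrow> ('o, 'm) arrow" where
  "nul A B n = Arrow A B n \<zero>\<^bsub>Hom C A B n\<^esub>"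

definition idn :: "'o \<Rightarrow> ('o, 'm) arrow" where
  "idn A = Arrow A A 0 (Ident C A)"

definition dif :: "('o, 'm) arrow \<Rightarrow> ('o, 'm) arrow" where
  "dif x = Arrow (src x) (tgt x) (deg x + 1) (Diff C (src x) (tgt x) (deg x) (val x))"

lemma boundary_simps [simp]:
  "src (x \<cdot> y) = src y" "tgt (x \<cdot> y) = tgt x" "deg (x \<cdot> y) = deg x + deg y"
  "src (x \<boxplus> y) = src x" "tgt (x \<boxplus> y) = tgt x" "deg (x \<boxplus> y) = deg x"
  "src (neg x) = src x" "tgt (neg x) = tgt x" "deg (neg x) = deg x"
  "src (nul A B n) = A" "tgt (nul A B n) = B" "deg (nul A B n) = n"
  "src (idn A) = A" "tgt (idn A) = A" "deg (idn A) = 0"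
  "src (dif x) = src x" "tgt (dif x) = tgt x" "deg (dif x) = deg x + 1"
  by (simp_all add: cmp_def plus_def neg_def nul_def idn_def dif_def)

lemma Hom_group: "\<lbrakk>A \<in> Ob C; B \<in> Ob C\<rbrakk> \<Longrightarrow> abelian_group (Hom C A B n)"
  using Hom_module by (simp add: module_def)

lemma arr_obj: "arr x \<Longrightarrow> src x \<in> Ob C" "arr x \<Longrightarrow> tgt x \<in> Ob C"
  by (simp_all add: arr_def)

lemma arr_group: "arr x \<Longrightarrow> abelian_group (Hom C (src x) (tgt x) (deg x))"
  by (simp add: arr_def Hom_group)

lemma arr_cmp [simp]: "\<lbrakk>arr x; arr y; src x = tgt y\<rbrakk> \<Longrightarrow> arr (x \<cdot> y)"
  by (auto simp: arr_def cmp_def intro: Comp_closed)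

lemma arr_plus [simp]:
  "\<lbrakk>arr x; arr y; src x = src y; tgt x = tgt y; deg x = deg y\<rbrakk> \<Longrightarrow> arr (x \<boxplus> y)"
  by (auto simp: arr_def plus_def intro!: abelian_monoid.a_closed abelian_group.axioms Hom_group)

lemma arr_neg [simp]: "arr x \<Longrightarrow> arr (neg x)"
  by (auto simp: arr_def neg_def intro!: abelian_group.a_inv_closed Hom_group)

lemma arr_nul [simp]: "\<lbrakk>A \<in> Ob C; B \<in> Ob C\<rbrakk> \<Longrightarrow> arr (nul A B n)"
  by (auto simp: arr_def nul_def intro!: abelian_monoid.zero_closed abelian_group.axioms Hom_group)

lemma arr_idn [simp]: "A \<in> Ob C \<Longrightarrow> arr (idn A)"
  by (simp add: arr_def idn_def Ident_closed)

lemma arr_dif [simp]: "arr x \<Longrightarrow> arr (dif x)"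
  by (auto simp: arr_def dif_def intro: Diff_closed)

lemma plus_assoc:
  assumes "arr x" "arr y" "arr z" "src x = src y" "src y = src z" "tgt x = tgt y" "tgt y = tgt z"
    "deg x = deg y" "deg y = deg z"
  shows "(x \<boxplus> y) \<boxplus> z = x \<boxplus> (y \<boxplus> z)"
proof -
  interpret abelian_group "Hom C (src z) (tgt z) (deg z)" using assms(3) by (rule arr_group)
  show ?thesis using assms by (simp add: plus_def arr_def a_assoc)
qed

lemma plus_commute:
  assumes "arr x" "arr y" "src x = src y" "tgt x = tgt y" "deg x = deg y"
  shows "x \<boxplus> y = y \<boxplus> x"
proof -
  interpret abelian_group "Hom C (src y) (tgt y) (deg y)" using assms(2) by (rule arr_group)
  show ?thesis using assms by (simp add: plus_def arr_def a_comm)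
qed

lemma plus_left_commute:
  assumes "arr x" "arr y" "arr z" "src x = src y" "src y = src z" "tgt x = tgt y" "tgt y = tgt z"
    "deg x = deg y" "deg y = deg z"
  shows "x \<boxplus> (y \<boxplus> z) = y \<boxplus> (x \<boxplus> z)"
  using assms plus_assoc[of x y z] plus_assoc[of y x z] plus_commute[of x y] by simp

lemmas plus_ac = plus_assoc plus_commute plus_left_commute

lemma plus_nul [simp]:
  assumes "arr x" "src x = A" "tgt x = B" "deg x = n"
  shows "x \<boxplus> nul A B n = x" "nul A B n \<boxplus> x = x"
proof -
  interpret abelian_group "Hom C (src x) (tgt x) (deg x)" using assms(1) by (rule arr_group)
  show "x \<boxplus> nul A B n = x" "nul A B n \<boxplus> x = x"
    using assms by (auto simp: plus_def arr_def nul_def arrow.expand)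
qed

lemma plus_neg [simp]:
  assumes "arr x"
  shows "x \<boxplus> neg x = nul (src x) (tgt x) (deg x)" "neg x \<boxplus> x = nul (src x) (tgt x) (deg x)"
proof -
  interpret abelian_group "Hom C (src x) (tgt x) (deg x)" using assms(1) by (rule arr_group)
  show "x \<boxplus> neg x = nul (src x) (tgt x) (deg x)" "neg x \<boxplus> x = nul (src x) (tgt x) (deg x)"
    using assms by (simp_all add: plus_def neg_def arr_def nul_def l_neg r_neg)
qed

lemma plus_neg_cancel [simp]:
  assumes "arr x" "arr y" "src x = src y" "tgt x = tgt y" "deg x = deg y"
  shows "x \<boxplus> (neg x \<boxplus> y) = y" "neg x \<boxplus> (x \<boxplus> y) = y"
  using assms by (simp_all flip: plus_assoc)

lemma neg_neg [simp]: "arr x \<Longrightarrow> neg (neg x) = x"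
  by (auto simp: neg_def arr_def arrow.expand abelian_group.minus_minus[OF Hom_group])

lemma neg_plus [simp]:
  assumes "arr x" "arr y" "src x = src y" "tgt x = tgt y" "deg x = deg y"
  shows "neg (x \<boxplus> y) = neg x \<boxplus> neg y"
proof -
  interpret abelian_group "Hom C (src y) (tgt y) (deg y)" using assms(2) by (rule arr_group)
  show ?thesis using assms by (simp add: plus_def neg_def arr_def minus_add)
qed

lemma neg_nul [simp]:
  assumes "A \<in> Ob C" "B \<in> Ob C"
  shows "neg (nul A B n) = nul A B n"
proof -
  interpret abelian_group "Hom C A B n" using assms by (rule Hom_group)
  show ?thesis by (simp add: neg_def nul_def)
qed

text \<open>Cancellation turns additivity into the laws for \<open>nul\<close> and
  \<open>neg\<close>: each is obtained below by adding a common summand on the left and cancelling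
  it.\<close>

lemma plus_left_imp_eq:
  assumes "arr x" "arr y" "arr z" "src x = src y" "src y = src z" "tgt x = tgt y" "tgt y = tgt z"
    "deg x = deg y" "deg y = deg z" "x \<boxplus> y = x \<boxplus> z"
  shows "y = z"
  by (metis assms plus_neg_cancel(2))

lemma cmp_plus:
  assumes "arr x" "arr y" "arr z" "src y = src z" "tgt y = tgt z" "deg y = deg z" "src x = tgt y"
  shows "x \<cdot> (y \<boxplus> z) = x \<cdot> y \<boxplus> x \<cdot> z"
  using assms by (auto simp: cmp_def plus_def arr_def intro: Comp_add_right)

lemma plus_cmp:
  assumes "arr x" "arr y" "arr z" "src y = src z" "tgt y = tgt z" "deg y = deg z" "src y = tgt x"
  shows "(y \<boxplus> z) \<cdot> x = y \<cdot> x \<boxplus> z \<cdot> x"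
  using assms by (auto simp: cmp_def plus_def arr_def intro: Comp_add_left)

lemma cmp_assoc:
  assumes "arr x" "arr y" "arr z" "src x = tgt y" "src y = tgt z"
  shows "(x \<cdot> y) \<cdot> z = x \<cdot> (y \<cdot> z)"
  using assms by (auto simp: cmp_def arr_def add.assoc intro: Comp_assoc)

lemma cmp_nul [simp]:
  assumes "arr x" "A \<in> Ob C" "src x = B"
  shows "x \<cdot> nul A B n = nul A (tgt x) (deg x + n)"
proof -
  have "x \<cdot> nul A B n = x \<cdot> (nul A B n \<boxplus> nul A B n)"
    using assms arr_obj[of x] by auto
  also have "\<dots> = x \<cdot> nul A B n \<boxplus> x \<cdot> nul A B n"
    using assms by (intro cmp_plus) (auto simp: arr_obj)
  finally show ?thesis
    using assms plus_left_imp_eq[of "x \<cdot> nul A B n" "x \<cdot> nul A B n" "nul A (tgt x) (deg x + n)"]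
    by (auto simp: arr_obj)
qed

lemma nul_cmp [simp]:
  assumes "arr x" "B \<in> Ob C" "tgt x = A"
  shows "nul A B n \<cdot> x = nul (src x) B (n + deg x)"
proof -
  have "nul A B n \<cdot> x = (nul A B n \<boxplus> nul A B n) \<cdot> x"
    using assms arr_obj[of x] by auto
  also have "\<dots> = nul A B n \<cdot> x \<boxplus> nul A B n \<cdot> x"
    using assms by (intro plus_cmp) (auto simp: arr_obj)
  finally show ?thesis
    using assms plus_left_imp_eq[of "nul A B n \<cdot> x" "nul A B n \<cdot> x" "nul (src x) B (n + deg x)"]
    by (auto simp: arr_obj)
qed

lemma cmp_neg [simp]:
  assumes "arr x" "arr y" "src x = tgt y"
  shows "x \<cdot> neg y = neg (x \<cdot> y)"
proof -
  have "x \<cdot> y \<boxplus> x \<cdot> neg y = x \<cdot> y \<boxplus> neg (x \<cdot> y)"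
    using assms by (simp add: arr_obj flip: cmp_plus)
  then show ?thesis
    using assms plus_left_imp_eq[of "x \<cdot> y" "x \<cdot> neg y" "neg (x \<cdot> y)"] by simp
qed

lemma neg_cmp [simp]:
  assumes "arr x" "arr y" "src x = tgt y"
  shows "neg x \<cdot> y = neg (x \<cdot> y)"
proof -
  have "x \<cdot> y \<boxplus> neg x \<cdot> y = x \<cdot> y \<boxplus> neg (x \<cdot> y)"
    using assms by (simp add: arr_obj flip: plus_cmp)
  then show ?thesis
    using assms plus_left_imp_eq[of "x \<cdot> y" "neg x \<cdot> y" "neg (x \<cdot> y)"] by simp
qed

lemma cmp_idn [simp]:
  "\<lbrakk>arr x; src x = A\<rbrakk> \<Longrightarrow> x \<cdot> idn A = x" "\<lbrakk>arr x; tgt x = A\<rbrakk> \<Longrightarrow> idn A \<cdot> x = x"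
  by (auto simp: cmp_def idn_def arr_def arrow.expand Comp_Ident_left Comp_Ident_right)

lemma dif_plus:
  assumes "arr x" "arr y" "src x = src y" "tgt x = tgt y" "deg x = deg y"
  shows "dif (x \<boxplus> y) = dif x \<boxplus> dif y"
  using assms by (auto simp: dif_def plus_def arr_def intro: Diff_add)

lemma dif_nul [simp]:
  assumes "A \<in> Ob C" "B \<in> Ob C"
  shows "dif (nul A B n) = nul A B (n + 1)"
proof -
  have "dif (nul A B n) \<boxplus> dif (nul A B n) = dif (nul A B n) \<boxplus> nul A B (n + 1)"
    using assms by (simp flip: dif_plus)
  then show ?thesis
    using assms plus_left_imp_eq[of "dif (nul A B n)" "dif (nul A B n)" "nul A B (n + 1)"] by simp
qed

lemma dif_neg [simp]:
  assumes "arr x"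
  shows "dif (neg x) = neg (dif x)"
proof -
  have "dif x \<boxplus> dif (neg x) = dif x \<boxplus> neg (dif x)"
    using assms by (simp add: arr_obj flip: dif_plus)
  then show ?thesis
    using assms plus_left_imp_eq[of "dif x" "dif (neg x)" "neg (dif x)"] by simp
qed

text \<open>The Koszul sign is kept as a conditional on the parity of \<open>deg x\<close>, which
  the simplifier decides once the degree is known.\<close>

lemma dif_cmp:
  assumes "arr x" "arr y" "src x = tgt y"
  shows "dif (x \<cdot> y) = dif x \<cdot> y \<boxplus> (if even (deg x) then x \<cdot> dif y else neg (x \<cdot> dif y))"
  using assms Leibniz[of "src y" "tgt y" "tgt x" "val x" "deg x" "val y" "deg y"]
  by (auto simp: dif_def cmp_def plus_def neg_def arr_def koszul_sign_def ac_simps)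

text \<open>The Leibniz rule for id = id id gives d(id) = d(id) + d(id).\<close>

lemma dif_idn [simp]:
  assumes "A \<in> Ob C"
  shows "dif (idn A) = nul A A 1"
proof -
  have "dif (idn A) = dif (idn A \<cdot> idn A)" using assms by simp
  also have "\<dots> = dif (idn A) \<boxplus> dif (idn A)" using assms by (subst dif_cmp) auto
  finally show ?thesis
    using assms plus_left_imp_eq[of "dif (idn A)" "dif (idn A)" "nul A A 1"] by simp
qed

end

section \<open>Series with signed Catalan numbers as coefficients\<close>

text \<open>
  Row \<open>n\<close> of the table is correct up to index \<open>n\<close>; this replaces a course-of-values recursion
  through \<^const>\<open>finsum\<close>.
\<close>

primrec (in cring) signed_catalan_table :: "nat \<Rightarrow> nat \<Rightarrow> 'a" where
  "signed_catalan_table 0 = (\<lambda>i. \<one>)"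
| "signed_catalan_table (Suc n) = (signed_catalan_table n)
     (Suc n := \<ominus> (\<Oplus>i\<in>{..n}. signed_catalan_table n i \<otimes> signed_catalan_table n (n - i)))"

definition (in cring) signed_catalan :: "nat \<Rightarrow> 'a" where
  "signed_catalan n = signed_catalan_table n n"

context cring
begin

lemma signed_catalan_table_closed: "signed_catalan_table n i \<in> carrier R"
proof (induction n arbitrary: i)
  case (Suc n)
  then show ?case by (auto intro!: a_inv_closed finsum_closed)
qed simp

lemma signed_catalan_closed [simp]: "signed_catalan n \<in> carrier R"
  by (simp add: signed_catalan_def signed_catalan_table_closed)

lemma signed_catalan_table_eq: "i \<le> n \<Longrightarrow> signed_catalan_table n i = signed_catalan i"
proof (induction n)
  case (Suc n)
  then show ?case by (cases "i = Suc n") (simp_all add: signed_catalan_def)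
qed (simp add: signed_catalan_def)

lemma signed_catalan_0 [simp]: "signed_catalan 0 = \<one>"
  by (simp add: signed_catalan_def)

text \<open>For the generating function E of the e_n this is E = 1 - \<epsilon> E^2. It makes S^2
  cancel every term of D S except the first.\<close>

lemma signed_catalan_Suc: "signed_catalan (Suc n) = \<ominus> (\<Oplus>i\<in>{..n}. signed_catalan i \<otimes> signed_catalan (n - i))"
proof -
  have "(\<Oplus>i\<in>{..n}. signed_catalan_table n i \<otimes> signed_catalan_table n (n - i)) =
        (\<Oplus>i\<in>{..n}. signed_catalan i \<otimes> signed_catalan (n - i))"
    by (rule finsum_cong') (auto simp: signed_catalan_table_eq)
  then show ?thesis by (simp add: signed_catalan_def)
qed

end

lemma (in module) finsum_smult_left:
  "\<lbrakk>finite A; f \<in> A \<rightarrow> carrier R; x \<in> carrier M\<rbrakk> \<Longrightarrow>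
    (\<Oplus>i\<in>A. f i) \<odot>\<^bsub>M\<^esub> x = (\<Oplus>\<^bsub>M\<^esub> i\<in>A. f i \<odot>\<^bsub>M\<^esub> x)"
proof (induct set: finite)
  case (insert i F)
  then show ?case by (simp add: Pi_def smult_l_distr)
qed simp

context dg_category
begin

section \<open>Scalar multiples of arrows\<close>

definition scl :: "'k \<Rightarrow> ('o, 'm) arrow \<Rightarrow> ('o, 'm) arrow" where
  "scl r x = Arrow (src x) (tgt x) (deg x) (r \<odot>\<^bsub>Hom C (src x) (tgt x) (deg x)\<^esub> val x)"

lemma boundary_scl [simp]: "src (scl r x) = src x" "tgt (scl r x) = tgt x" "deg (scl r x) = deg x"
  by (simp_all add: scl_def)

lemma arr_module: "arr x \<Longrightarrow> module R (Hom C (src x) (tgt x) (deg x))"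
  by (simp add: arr_def Hom_module)

lemma arr_scl [simp]: "\<lbrakk>r \<in> carrier R; arr x\<rbrakk> \<Longrightarrow> arr (scl r x)"
  by (auto simp: arr_def scl_def intro!: module.smult_closed Hom_module)

lemma scl_one [simp]: "arr x \<Longrightarrow> scl \<one> x = x"
  by (auto simp: arr_def scl_def module.smult_one[OF Hom_module])

lemma scl_plus:
  assumes "r \<in> carrier R" "arr x" "arr y" "src x = src y" "tgt x = tgt y" "deg x = deg y"
  shows "scl r (x \<boxplus> y) = scl r x \<boxplus> scl r y"
  using assms module.smult_r_distr[OF arr_module[of y], of r "val x" "val y"]
  by (simp add: scl_def plus_def arr_def)

lemma scl_neg [simp]:
  assumes "r \<in> carrier R" "arr x"
  shows "scl r (neg x) = neg (scl r x)"
  using assms module.smult_r_minus[OF arr_module[of x], of r "val x"]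
  by (simp add: scl_def neg_def arr_def)

lemma scl_nul [simp]:
  assumes "r \<in> carrier R" "A \<in> Ob C" "B \<in> Ob C"
  shows "scl r (nul A B n) = nul A B n"
  using assms module.smult_r_null[OF Hom_module] by (simp add: scl_def nul_def)

lemma scl_cmp [simp]:
  assumes "r \<in> carrier R" "arr x" "arr y" "src x = tgt y"
  shows "scl r x \<cdot> y = scl r (x \<cdot> y)" "x \<cdot> scl r y = scl r (x \<cdot> y)"
  using assms by (auto simp: cmp_def scl_def arr_def Comp_smult_left Comp_smult_right)

lemma scl_scl:
  assumes "r \<in> carrier R" "s \<in> carrier R" "arr x"
  shows "scl r (scl s x) = scl (r \<otimes> s) x"
  using assms module.smult_assoc1[OF arr_module[of x], of r s "val x"]
  by (simp add: scl_def arr_def)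

lemma dif_scl [simp]:
  assumes "r \<in> carrier R" "arr x"
  shows "dif (scl r x) = scl r (dif x)"
  using assms by (auto simp: dif_def scl_def arr_def Diff_smult)

section \<open>Coefficientwise description of C[[\<epsilon>]]\<close>

definition coef :: "'o \<Rightarrow> 'o \<Rightarrow> int \<Rightarrow> (nat \<Rightarrow> 'm) \<Rightarrow> nat \<Rightarrow> ('o, 'm) arrow" where
  "coef A B q s i = Arrow A B (q - 2 * int i) (s i)"

text \<open>The weight e_i is built in, so that \<open>u\<close> can run through the matrix entries
  of the odd powers of s.\<close>

definition series :: "(nat \<Rightarrow> ('o, 'm) arrow) \<Rightarrow> nat \<Rightarrow> 'm" where
  "series u i = val (scl (signed_catalan i) (u i))"

lemma boundary_coef [simp]:
  "src (coef A B q s i) = A" "tgt (coef A B q s i) = B" "deg (coef A B q s i) = q - 2 * int i"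
  by (simp_all add: coef_def)

lemma series_eqI: "(\<And>i. coef A B q s i = coef A B q t i) \<Longrightarrow> s = t"
  by (auto simp: coef_def)

lemma eps_carrier_iff:
  "\<lbrakk>A \<in> Ob C; B \<in> Ob C\<rbrakk> \<Longrightarrow>
    s \<in> carrier (Hom (eps_category C) A B q) \<longleftrightarrow> (\<forall>i. arr (coef A B q s i))"
  by (simp add: eps_category_def eps_Hom_def arr_def coef_def)

text \<open>Subtraction in the hom modules of C[[\<epsilon>]] uses an inverse defined by
  description. The group laws give its uniqueness, and so allow it to be computed coefficientwise in
  \<open>coef_minus\<close>.\<close>

lemma eps_abelian_group:
  assumes "A \<in> Ob C" "B \<in> Ob C"
  shows "abelian_group (Hom (eps_category C) A B q)"
proof -
  interpret H: abelian_group "Hom C A B l" for l using assms by (rule Hom_group)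
  show ?thesis
  proof (rule abelian_groupI)
    fix s assume "s \<in> carrier (Hom (eps_category C) A B q)"
    then show "\<exists>t\<in>carrier (Hom (eps_category C) A B q).
        t \<oplus>\<^bsub>Hom (eps_category C) A B q\<^esub> s = \<zero>\<^bsub>Hom (eps_category C) A B q\<^esub>"
      by (intro bexI[of _ "\<lambda>i. \<ominus>\<^bsub>Hom C A B (q - 2 * int i)\<^esub> s i"])
        (auto simp: eps_category_def eps_Hom_def H.l_neg)
  next
    show "\<And>s. s \<in> carrier (Hom (eps_category C) A B q) \<Longrightarrow>
      \<zero>\<^bsub>Hom (eps_category C) A B q\<^esub> \<oplus>\<^bsub>Hom (eps_category C) A B q\<^esub> s = s"
      by (simp add: eps_category_def eps_Hom_def)
  qed (simp_all add: eps_category_def eps_Hom_def H.a_ac)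
qed

lemma coef_minus:
  assumes "A \<in> Ob C" "B \<in> Ob C"
    "s \<in> carrier (Hom (eps_category C) A B q)" "t \<in> carrier (Hom (eps_category C) A B q)"
  shows "coef A B q (s \<ominus>\<^bsub>Hom (eps_category C) A B q\<^esub> t) i = coef A B q s i \<boxplus> neg (coef A B q t i)"
proof -
  interpret H: abelian_group "Hom C A B l" for l using assms(1,2) by (rule Hom_group)
  interpret E: abelian_group "Hom (eps_category C) A B q" using assms(1,2) by (rule eps_abelian_group)
  have "\<ominus>\<^bsub>Hom (eps_category C) A B q\<^esub> t = (\<lambda>i. \<ominus>\<^bsub>Hom C A B (q - 2 * int i)\<^esub> t i)"
    using assms(4) by (intro E.minus_equality) (auto simp: eps_category_def eps_Hom_def H.l_neg)
  then show ?thesis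
    by (simp add: a_minus_def coef_def plus_def neg_def) (simp add: eps_category_def eps_Hom_def)
qed

lemma coef_Diff: "coef A B (q + 1) (Diff (eps_category C) A B q s) i = dif (coef A B q s i)"
  by (simp add: coef_def dif_def eps_category_def algebra_simps)

lemma coef_Ident:
  "coef A A 0 (Ident (eps_category C) A) i = (if i = 0 then idn A else nul A A (- 2 * int i))"
  by (simp add: coef_def idn_def nul_def eps_category_def)

lemma coef_eps_mult:
  "coef A B (q + 2) (eps_mult C A B q s) i =
     (case i of 0 \<Rightarrow> nul A B (q + 2) | Suc j \<Rightarrow> coef A B q s j)"
  by (simp add: coef_def nul_def eps_mult_def algebra_simps split: nat.split)

lemma eps_mult_closed:
  "s \<in> carrier (Hom (eps_category C) A B q) \<Longrightarrow>
    eps_mult C A B q s \<in> carrier (Hom (eps_category C) A B (q + 2))" if "A \<in> Ob C" "B \<in> Ob C"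
  using that by (auto simp: eps_carrier_iff coef_eps_mult split: nat.split)

text \<open>This is the common right-hand side of the equations for d(h) and d(k). From \<epsilon>^1
  on the identity is gone, and the two remaining terms are collected under one sign so that they
  form an entry of S^2.\<close>

lemma coef_Ident_minus:
  assumes "A \<in> Ob C" "s \<in> carrier (Hom (eps_category C) A A 0)"
    "t \<in> carrier (Hom (eps_category C) A A (-2))"
  shows "coef A A 0 (Ident (eps_category C) A \<ominus>\<^bsub>Hom (eps_category C) A A 0\<^esub> s
      \<ominus>\<^bsub>Hom (eps_category C) A A 0\<^esub> eps_mult C A A (-2) t) i =
    (case i of 0 \<Rightarrow> idn A \<boxplus> neg (coef A A 0 s 0)
      | Suc p \<Rightarrow> neg (coef A A 0 s (Suc p) \<boxplus> coef A A (-2) t p))"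
proof -
  interpret E: abelian_group "Hom (eps_category C) A A 0" using assms(1,1) by (rule eps_abelian_group)
  have I: "Ident (eps_category C) A \<in> carrier (Hom (eps_category C) A A 0)"
    using assms(1) by (simp add: eps_carrier_iff coef_Ident)
  have M: "eps_mult C A A (-2) t \<in> carrier (Hom (eps_category C) A A 0)"
    using eps_mult_closed[OF assms(1,1,3)] by simp
  have arrs: "arr (coef A A 0 s j)" "arr (coef A A (-2) t j)" for j
    using assms by (simp_all add: eps_carrier_iff)
  show ?thesis
    using assms(1) arrs coef_eps_mult[of A A "-2" t i]
    by (simp add: coef_minus[OF assms(1,1) E.minus_closed[OF I assms(2)] M]
        coef_minus[OF assms(1,1) I assms(2)] coef_Ident split: nat.split)
qed

section \<open>Coefficients of composites\<close>

lemma eps_Comp_summand: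
  assumes "W \<in> Ob C" "A \<in> Ob C" "Z \<in> Ob C"
    "s \<in> carrier (Hom (eps_category C) A Z m)" "t \<in> carrier (Hom (eps_category C) W A n)" "j \<le> i"
  shows "Comp C W A Z (m - 2 * int j) (n - 2 * int (i - j)) (s j) (t (i - j))
      \<in> carrier (Hom C W Z (m + n - 2 * int i))"
proof -
  have "m + n - 2 * int i = (m - 2 * int j) + (n - 2 * int (i - j))"
    using assms(6) by (simp add: of_nat_diff)
  moreover have "s j \<in> carrier (Hom C A Z (m - 2 * int j))"
    "t (i - j) \<in> carrier (Hom C W A (n - 2 * int (i - j)))"
    using assms(4,5) by (simp_all add: eps_category_def eps_Hom_def)
  ultimately show ?thesis
    using assms(1-3) by (simp only: Comp_closed)
qed

lemma eps_Comp_closed: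
  assumes "W \<in> Ob C" "A \<in> Ob C" "Z \<in> Ob C"
    "s \<in> carrier (Hom (eps_category C) A Z m)" "t \<in> carrier (Hom (eps_category C) W A n)"
  shows "Comp (eps_category C) W A Z m n s t \<in> carrier (Hom (eps_category C) W Z (m + n))"
proof -
  interpret H: abelian_group "Hom C W Z l" for l using assms(1,3) by (rule Hom_group)
  show ?thesis
    using eps_Comp_summand[OF assms]
    by (auto simp: eps_category_def eps_Hom_def intro!: H.finsum_closed)
qed

lemma coef_Comp_0:
  assumes "W \<in> Ob C" "A \<in> Ob C" "Z \<in> Ob C"
    "s \<in> carrier (Hom (eps_category C) A Z m)" "t \<in> carrier (Hom (eps_category C) W A n)"
  shows "coef W Z (m + n) (Comp (eps_category C) W A Z m n s t) 0 = coef A Z m s 0 \<cdot> coef W A n t 0"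
proof -
  interpret H: abelian_group "Hom C W Z l" for l using assms(1,3) by (rule Hom_group)
  have "Comp C W A Z m n (s 0) (t 0) \<in> carrier (Hom C W Z (m + n))"
    using eps_Comp_summand[OF assms, of 0 0] by simp
  then show ?thesis
    by (simp add: coef_def cmp_def eps_category_def)
qed

lemma case_nat_closed:
  assumes "x \<in> carrier (Hom C A B q)" "s \<in> carrier (Hom (eps_category C) A B (q - 2))"
  shows "case_nat x s \<in> carrier (Hom (eps_category C) A B q)"
  using assms by (auto simp: eps_category_def eps_Hom_def algebra_simps split: nat.split)

text \<open>The series \<open>case_nat x t\<close> is x + \<epsilon> t, so composing with it gives s
  x + \<epsilon> (s t). It is meant for G = g + \<epsilon> B, whose constant term does not carry the
  Catalan weights of B.\<close>

lemma coef_Comp_case_nat_right: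
  assumes "W \<in> Ob C" "A \<in> Ob C" "Z \<in> Ob C" "s \<in> carrier (Hom (eps_category C) A Z m)"
    "x \<in> carrier (Hom C W A n)" "t \<in> carrier (Hom (eps_category C) W A (n - 2))"
  shows "coef W Z (m + n) (Comp (eps_category C) W A Z m n s (case_nat x t)) (Suc p) =
    coef A Z m s (Suc p) \<cdot> Arrow W A n x \<boxplus>
    coef W Z (m + n - 2) (Comp (eps_category C) W A Z m (n - 2) s t) p"
proof -
  interpret H: abelian_group "Hom C W Z l" for l using assms(1,3) by (rule Hom_group)
  let ?H = "Hom C W Z (m + n - 2 * int (Suc p))"
  let ?F = "\<lambda>j. Comp C W A Z (m - 2 * int j) (n - 2 * int (Suc p - j)) (s j)
    (case_nat x t (Suc p - j))"
  let ?G = "\<lambda>j. Comp C W A Z (m - 2 * int j) (n - 2 - 2 * int (p - j)) (s j) (t (p - j))"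
  note ct = case_nat_closed[OF assms(5,6)]
  have F: "?F j \<in> carrier ?H" if "j \<le> Suc p" for j
    using eps_Comp_summand[OF assms(1-4) ct that] by simp
  \<comment> \<open>For j \<le> p the index \<open>Suc p - j\<close> is a successor, so
    \<open>case_nat\<close> selects \<open>t\<close>, and the two degrees of one \<epsilon> pass
    from the index to \<open>n - 2\<close>.\<close>
  have FG: "?F j = ?G j" if "j \<le> p" for j
    using that by (simp add: Suc_diff_le algebra_simps)
  have G: "?G j \<in> carrier ?H" if "j \<le> p" for j
    using F[of j] FG[OF that] that by (metis le_SucI)
  have "finsum ?H ?F {..Suc p} = ?F (Suc p) \<oplus>\<^bsub>?H\<^esub> finsum ?H ?F {..p}"
    using F by (intro H.finsum_Suc) auto
  also have "finsum ?H ?F {..p} = finsum ?H ?G {..p}"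
    by (rule H.finsum_cong') (auto simp only: Pi_iff atMost_iff FG G)
  finally show ?thesis
    by (simp add: coef_def cmp_def plus_def eps_category_def algebra_simps)
qed

text \<open>Mirror image of the previous lemma: the constant term now sits at j = 0, so the summand
  is split off at the front.\<close>

lemma coef_Comp_case_nat_left:
  assumes "W \<in> Ob C" "A \<in> Ob C" "Z \<in> Ob C" "x \<in> carrier (Hom C A Z m)"
    "s \<in> carrier (Hom (eps_category C) A Z (m - 2))" "t \<in> carrier (Hom (eps_category C) W A n)"
  shows "coef W Z (m + n) (Comp (eps_category C) W A Z m n (case_nat x s) t) (Suc p) =
    coef W Z (m + n - 2) (Comp (eps_category C) W A Z (m - 2) n s t) p \<boxplus>
    Arrow A Z m x \<cdot> coef W A n t (Suc p)"
proof -
  interpret H: abelian_group "Hom C W Z l" for l using assms(1,3) by (rule Hom_group)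
  let ?H = "Hom C W Z (m + n - 2 * int (Suc p))"
  let ?F = "\<lambda>j. Comp C W A Z (m - 2 * int j) (n - 2 * int (Suc p - j)) (case_nat x s j)
    (t (Suc p - j))"
  let ?G = "\<lambda>j. Comp C W A Z (m - 2 - 2 * int j) (n - 2 * int (p - j)) (s j) (t (p - j))"
  note cs = case_nat_closed[OF assms(4,5)]
  have F: "?F j \<in> carrier ?H" if "j \<le> Suc p" for j
    using eps_Comp_summand[OF assms(1-3) cs assms(6) that] by simp
  have FG: "?F (Suc j) = ?G j" for j
    by (simp add: algebra_simps)
  have "finsum ?H ?F {..Suc p} = finsum ?H (\<lambda>j. ?F (Suc j)) {..p} \<oplus>\<^bsub>?H\<^esub> ?F 0"
    using F by (intro H.finsum_Suc2) auto
  also have "finsum ?H (\<lambda>j. ?F (Suc j)) {..p} = finsum ?H ?G {..p}"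
    unfolding FG ..
  finally show ?thesis
    by (simp add: coef_def cmp_def plus_def eps_category_def algebra_simps)
qed

section \<open>Convolutions weighted by the signed Catalan numbers\<close>

definition catalan_sum :: "'o \<Rightarrow> 'o \<Rightarrow> int \<Rightarrow> nat \<Rightarrow> (nat \<Rightarrow> ('o, 'm) arrow) \<Rightarrow> ('o, 'm) arrow" where
  "catalan_sum A B q p u = Arrow A B q
     (\<Oplus>\<^bsub>Hom C A B q\<^esub> j\<in>{..p}. (signed_catalan j \<otimes> signed_catalan (p - j)) \<odot>\<^bsub>Hom C A B q\<^esub> val (u j))"

definition in_hom :: "'o \<Rightarrow> 'o \<Rightarrow> int \<Rightarrow> ('o, 'm) arrow \<Rightarrow> bool" where
  "in_hom A B q x \<longleftrightarrow> arr x \<and> src x = A \<and> tgt x = B \<and> deg x = q"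

lemma in_hom_val: "in_hom A B q x \<Longrightarrow> val x \<in> carrier (Hom C A B q)"
  by (auto simp: in_hom_def arr_def)

lemma in_hom_plus: "\<lbrakk>in_hom A B q x; in_hom A B q y\<rbrakk> \<Longrightarrow> in_hom A B q (x \<boxplus> y)"
  by (simp add: in_hom_def)

lemma in_hom_neg: "in_hom A B q x \<Longrightarrow> in_hom A B q (neg x)"
  by (simp add: in_hom_def)

lemma catalan_sum_cong:
  assumes "\<And>j. j \<le> p \<Longrightarrow> in_hom A B q (u j)" "\<And>j. j \<le> p \<Longrightarrow> u j = v j" "A \<in> Ob C" "B \<in> Ob C"
  shows "catalan_sum A B q p u = catalan_sum A B q p v"
proof -
  interpret H: module R "Hom C A B q" using assms(3,4) by (rule Hom_module)
  show ?thesis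
    unfolding catalan_sum_def using assms(1,2)
    by (auto intro!: H.finsum_cong' H.smult_closed in_hom_val)
qed

lemma catalan_sum_plus:
  assumes "\<And>j. j \<le> p \<Longrightarrow> in_hom A B q (u j)" "\<And>j. j \<le> p \<Longrightarrow> in_hom A B q (v j)"
    "A \<in> Ob C" "B \<in> Ob C"
  shows "catalan_sum A B q p u \<boxplus> catalan_sum A B q p v = catalan_sum A B q p (\<lambda>j. u j \<boxplus> v j)"
proof -
  interpret H: module R "Hom C A B q" using assms(3,4) by (rule Hom_module)
  let ?e = "\<lambda>j. signed_catalan j \<otimes> signed_catalan (p - j)"
  have U: "val (u j) \<in> carrier (Hom C A B q)" "val (v j) \<in> carrier (Hom C A B q)" if "j \<le> p" for j
    using assms(1,2)[OF that] by (auto simp: in_hom_def arr_def)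
  have "(\<Oplus>\<^bsub>Hom C A B q\<^esub> j\<in>{..p}. ?e j \<odot>\<^bsub>Hom C A B q\<^esub> val (u j \<boxplus> v j)) =
    (\<Oplus>\<^bsub>Hom C A B q\<^esub> j\<in>{..p}. ?e j \<odot>\<^bsub>Hom C A B q\<^esub> val (u j) \<oplus>\<^bsub>Hom C A B q\<^esub>
      ?e j \<odot>\<^bsub>Hom C A B q\<^esub> val (v j))"
    using U assms(1)
    by (intro H.finsum_cong') (auto simp: plus_def in_hom_def H.smult_r_distr)
  also have "\<dots> = (\<Oplus>\<^bsub>Hom C A B q\<^esub> j\<in>{..p}. ?e j \<odot>\<^bsub>Hom C A B q\<^esub> val (u j)) \<oplus>\<^bsub>Hom C A B q\<^esub>
    (\<Oplus>\<^bsub>Hom C A B q\<^esub> j\<in>{..p}. ?e j \<odot>\<^bsub>Hom C A B q\<^esub> val (v j))"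
    using U by (intro H.finsum_addf) auto
  finally show ?thesis by (simp add: catalan_sum_def plus_def)
qed

text \<open>A constant factors out of the sum, and the remaining scalar is the Catalan
  recursion.\<close>

lemma catalan_sum_const:
  assumes "in_hom A B q z"
  shows "catalan_sum A B q p (\<lambda>_. z) = neg (scl (signed_catalan (Suc p)) z)"
proof -
  have z: "A \<in> Ob C" "B \<in> Ob C" "val z \<in> carrier (Hom C A B q)" "src z = A" "tgt z = B" "deg z = q"
    using assms by (auto simp: in_hom_def arr_def)
  interpret H: module R "Hom C A B q" using z(1,2) by (rule Hom_module)
  have "(\<Oplus>j\<in>{..p}. signed_catalan j \<otimes> signed_catalan (p - j)) \<odot>\<^bsub>Hom C A B q\<^esub> val z =
      (\<Oplus>\<^bsub>Hom C A B q\<^esub> j\<in>{..p}. (signed_catalan j \<otimes> signed_catalan (p - j)) \<odot>\<^bsub>Hom C A B q\<^esub> val z)"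
    using z(3) by (intro H.finsum_smult_left) auto
  then show ?thesis
    using z by (simp add: catalan_sum_def neg_def scl_def signed_catalan_Suc H.smult_l_minus)
qed

lemma catalan_sum_neg:
  assumes "\<And>j. j \<le> p \<Longrightarrow> in_hom A B q (u j)" "A \<in> Ob C" "B \<in> Ob C"
  shows "catalan_sum A B q p (\<lambda>j. neg (u j)) = neg (catalan_sum A B q p u)"
proof -
  interpret H: module R "Hom C A B q" using assms(2,3) by (rule Hom_module)
  have arr: "arr (catalan_sum A B q p v)" if "\<And>j. j \<le> p \<Longrightarrow> in_hom A B q (v j)" for v
    using that assms(2,3)
    by (auto simp: catalan_sum_def arr_def intro!: H.finsum_closed H.smult_closed in_hom_val)
  have n: "\<And>j. j \<le> p \<Longrightarrow> in_hom A B q (neg (u j))"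
    using assms(1) by (simp add: in_hom_def)
  have "catalan_sum A B q p u \<boxplus> catalan_sum A B q p (\<lambda>j. neg (u j)) = catalan_sum A B q p (\<lambda>_. nul A B q)"
    using assms n by (subst catalan_sum_plus) (auto intro!: catalan_sum_cong simp: in_hom_def)
  also have "\<dots> = nul A B q"
    using assms(2,3) by (subst catalan_sum_const) (auto simp: in_hom_def)
  finally have "catalan_sum A B q p u \<boxplus> catalan_sum A B q p (\<lambda>j. neg (u j)) =
      catalan_sum A B q p u \<boxplus> neg (catalan_sum A B q p u)"
    using arr[OF assms(1)] by (simp add: catalan_sum_def)
  then show ?thesis
    using plus_left_imp_eq[of "catalan_sum A B q p u" "catalan_sum A B q p (\<lambda>j. neg (u j))"
        "neg (catalan_sum A B q p u)"] arr[OF assms(1)] arr[OF n] by (simp add: catalan_sum_def)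
qed

lemma coef_series:
  assumes "\<And>i. in_hom A B (q - 2 * int i) (u i)"
  shows "coef A B q (series u) i = scl (signed_catalan i) (u i)"
  using assms[of i] by (auto simp: coef_def series_def scl_def in_hom_def)

lemma series_closed:
  assumes "\<And>i. in_hom A B (q - 2 * int i) (u i)" "A \<in> Ob C" "B \<in> Ob C"
  shows "series u \<in> carrier (Hom (eps_category C) A B q)"
  using assms by (simp add: eps_carrier_iff coef_series) (simp add: in_hom_def)

lemma coef_Comp_series:
  assumes "W \<in> Ob C" "A \<in> Ob C" "Z \<in> Ob C"
    "\<And>i. in_hom A Z (m - 2 * int i) (u i)" "\<And>i. in_hom W A (n - 2 * int i) (v i)"
  shows "coef W Z (m + n) (Comp (eps_category C) W A Z m n (series u) (series v)) p =
    catalan_sum W Z (m + n - 2 * int p) p (\<lambda>j. u j \<cdot> v (p - j))"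
proof -
  let ?H = "Hom C W Z (m + n - 2 * int p)"
  interpret H: module R ?H using assms(1,3) by (rule Hom_module)
  have "Comp C W A Z (m - 2 * int j) (n - 2 * int (p - j)) (series u j) (series v (p - j)) =
      (signed_catalan j \<otimes> signed_catalan (p - j)) \<odot>\<^bsub>?H\<^esub> val (u j \<cdot> v (p - j))"
    and "(signed_catalan j \<otimes> signed_catalan (p - j)) \<odot>\<^bsub>?H\<^esub> val (u j \<cdot> v (p - j)) \<in> carrier ?H"
    if "j \<le> p" for j
  proof -
    have U: "arr (u j)" "src (u j) = A" "tgt (u j) = Z" "deg (u j) = m - 2 * int j"
      "arr (v (p - j))" "src (v (p - j)) = W" "tgt (v (p - j)) = A"
      "deg (v (p - j)) = n - 2 * int (p - j)"
      using assms(4,5) by (auto simp: in_hom_def)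
    have D: "deg (u j) + deg (v (p - j)) = m + n - 2 * int p"
      using that by (simp add: U of_nat_diff)
    have "scl (signed_catalan j) (u j) \<cdot> scl (signed_catalan (p - j)) (v (p - j)) =
        scl (signed_catalan j \<otimes> signed_catalan (p - j)) (u j \<cdot> v (p - j))"
      using U by (simp add: scl_scl m_comm)
    then have "val (scl (signed_catalan j) (u j) \<cdot> scl (signed_catalan (p - j)) (v (p - j))) =
        val (scl (signed_catalan j \<otimes> signed_catalan (p - j)) (u j \<cdot> v (p - j)))" by simp
    moreover have "val (scl (signed_catalan j \<otimes> signed_catalan (p - j)) (u j \<cdot> v (p - j))) =
        (signed_catalan j \<otimes> signed_catalan (p - j)) \<odot>\<^bsub>?H\<^esub> val (u j \<cdot> v (p - j))"
      unfolding scl_def arrow.sel boundary_simps D unfolding U ..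
    moreover have "val (scl (signed_catalan j) (u j) \<cdot> scl (signed_catalan (p - j)) (v (p - j))) =
        Comp C W A Z (m - 2 * int j) (n - 2 * int (p - j)) (series u j) (series v (p - j))"
      unfolding cmp_def series_def using U by simp
    ultimately show "Comp C W A Z (m - 2 * int j) (n - 2 * int (p - j)) (series u j)
        (series v (p - j)) = (signed_catalan j \<otimes> signed_catalan (p - j)) \<odot>\<^bsub>?H\<^esub> val (u j \<cdot> v (p - j))"
      by simp
    have "in_hom W Z (m + n - 2 * int p) (u j \<cdot> v (p - j))"
      using U that by (simp add: in_hom_def of_nat_diff)
    then show "(signed_catalan j \<otimes> signed_catalan (p - j)) \<odot>\<^bsub>?H\<^esub> val (u j \<cdot> v (p - j)) \<in> carrier ?H"
      by (simp add: in_hom_val)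
  qed
  then show ?thesis
    by (auto simp: coef_def catalan_sum_def eps_category_def intro!: H.finsum_cong')
qed

text \<open>An entry of S^2 is a sum of two composites. Its j-th terms add up to an entry of
  s^(2j+1) s^(2(p-j)+1) = s^(2p+2), which does not depend on j, so the convolution collapses to a
  single power. The second version serves the equations that contain a difference.\<close>

lemma coef_Comp_series_sum:
  fixes p :: nat
  assumes "W \<in> Ob C" "A \<in> Ob C" "B \<in> Ob C" "Z \<in> Ob C"
    "\<And>i. in_hom A Z (m - 2 * int i) (u i)" "\<And>i. in_hom W A (n - 2 * int i) (v i)"
    "\<And>i. in_hom B Z (m' - 2 * int i) (u' i)" "\<And>i. in_hom W B (n' - 2 * int i) (v' i)"
    "m + n = q" "m' + n' = q"
  defines "s \<equiv> coef W Z q (Comp (eps_category C) W A Z m n (series u) (series v)) p"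
    and "t \<equiv> coef W Z q (Comp (eps_category C) W B Z m' n' (series u') (series v')) p"
  shows "(\<And>j. j \<le> p \<Longrightarrow> u j \<cdot> v (p - j) \<boxplus> u' j \<cdot> v' (p - j) = z) \<Longrightarrow>
      s \<boxplus> t = neg (scl (signed_catalan (Suc p)) z)"
    and "(\<And>j. j \<le> p \<Longrightarrow> u j \<cdot> v (p - j) \<boxplus> neg (u' j \<cdot> v' (p - j)) = z) \<Longrightarrow>
      s \<boxplus> neg t = neg (scl (signed_catalan (Suc p)) z)"
proof -
  let ?q = "q - 2 * int p"
  have uv: "in_hom W Z ?q (u j \<cdot> v (p - j))" "in_hom W Z ?q (u' j \<cdot> v' (p - j))" if "j \<le> p" for j
    using assms(5)[of j] assms(6)[of "p - j"] assms(7)[of j] assms(8)[of "p - j"] assms(9,10) that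
    by (auto simp: in_hom_def of_nat_diff)
  have s: "s = catalan_sum W Z ?q p (\<lambda>j. u j \<cdot> v (p - j))"
    using coef_Comp_series[OF assms(1,2,4-6)] assms(9) by (simp add: s_def)
  have t: "t = catalan_sum W Z ?q p (\<lambda>j. u' j \<cdot> v' (p - j))"
    using coef_Comp_series[OF assms(1,3,4,7,8)] assms(10) by (simp add: t_def)
  have const: "catalan_sum W Z ?q p x = neg (scl (signed_catalan (Suc p)) z)"
    if "\<And>j. j \<le> p \<Longrightarrow> in_hom W Z ?q (x j)" "\<And>j. j \<le> p \<Longrightarrow> x j = z" for x
    using catalan_sum_cong[of p W Z ?q x "\<lambda>_. z"] catalan_sum_const[of W Z ?q z p] that that(1)[of 0]
      assms(1,4) by auto
  show "s \<boxplus> t = neg (scl (signed_catalan (Suc p)) z)"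
    if "\<And>j. j \<le> p \<Longrightarrow> u j \<cdot> v (p - j) \<boxplus> u' j \<cdot> v' (p - j) = z"
    unfolding s t using uv assms(1,4) that
    by (subst catalan_sum_plus) (auto intro!: const in_hom_plus simp del: boundary_simps)
  show "s \<boxplus> neg t = neg (scl (signed_catalan (Suc p)) z)"
    if "\<And>j. j \<le> p \<Longrightarrow> u j \<cdot> v (p - j) \<boxplus> neg (u' j \<cdot> v' (p - j)) = z"
    unfolding s t using uv assms(1,4) that
    by (subst catalan_sum_neg[symmetric], simp_all, subst catalan_sum_plus)
      (auto intro!: const in_hom_plus in_hom_neg)
qed

end

section \<open>Powers of the contraction of the cone\<close>

text \<open>\<open>dif_g\<close> makes the differential of the cone square to zero; the other four
  equations for differentials are the four entries of D s = 1.\<close>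

locale cone_contraction = dg_category R C
  for R :: "('k, 'r) ring_scheme" (structure) and C :: "('o, 'k, 'm) dgcat" +
  fixes X Y :: 'o and f g h k w :: "('o, 'm) arrow"
  assumes X_obj: "X \<in> Ob C" and Y_obj: "Y \<in> Ob C"
    and f_arr: "arr f" "src f = X" "tgt f = Y" "deg f = 0"
    and g_arr: "arr g" "src g = Y" "tgt g = X" "deg g = 0"
    and h_arr: "arr h" "src h = X" "tgt h = X" "deg h = -1"
    and k_arr: "arr k" "src k = Y" "tgt k = Y" "deg k = -1"
    and w_arr: "arr w" "src w = Y" "tgt w = X" "deg w = -2"
    and dif_f: "dif f = nul X Y 1"
    and dif_g: "dif g = nul Y X 1"
    and dif_h: "dif h = idn X \<boxplus> neg (g \<cdot> f)"
    and dif_k: "dif k = idn Y \<boxplus> neg (f \<cdot> g)"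
    and dif_w: "dif w = g \<cdot> k \<boxplus> neg (h \<cdot> g)"
begin

lemmas typing = X_obj Y_obj f_arr g_arr h_arr k_arr w_arr

text \<open>
  A column with source \<open>A\<close> is a morphism from \<open>A\<close> to the cone of \<open>g\<close>, where \<open>Y\<close> occurs shifted by
  one; \<open>step\<close> is multiplication by \<open>s\<close>, and \<open>a\<close>, \<open>b\<close> (first row), \<open>c\<close>, \<open>d\<close> (second row) are the
  entries of the powers of \<open>s\<close>.
\<close>

definition step :: "('o, 'm) arrow \<times> ('o, 'm) arrow \<Rightarrow> ('o, 'm) arrow \<times> ('o, 'm) arrow" where
  "step v = (h \<cdot> fst v \<boxplus> w \<cdot> snd v, f \<cdot> fst v \<boxplus> neg (k \<cdot> snd v))"

definition column :: "'o \<Rightarrow> int \<Rightarrow> ('o, 'm) arrow \<times> ('o, 'm) arrow \<Rightarrow> bool" where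
  "column A m v \<longleftrightarrow>
     arr (fst v) \<and> src (fst v) = A \<and> tgt (fst v) = X \<and> deg (fst v) = m \<and>
     arr (snd v) \<and> src (snd v) = A \<and> tgt (snd v) = Y \<and> deg (snd v) = m + 1"

lemma column_step: "column A m v \<Longrightarrow> column A (m - 1) (step v)"
  by (simp add: step_def column_def typing)

lemma column_steps: "column A m v \<Longrightarrow> column A (m - int n) ((step ^^ n) v)"
proof (induction n)
  case (Suc n)
  then show ?case using column_step[of A "m - int n"] by (simp add: algebra_simps)
qed simp

definition "a n = fst ((step ^^ n) (idn X, nul X Y 1))"
definition "c n = snd ((step ^^ n) (idn X, nul X Y 1))"
definition "b n = fst ((step ^^ n) (nul Y X (-1), idn Y))"
definition "d n = snd ((step ^^ n) (nul Y X (-1), idn Y))"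

lemma entries_typing [simp]:
  "arr (a n)" "src (a n) = X" "tgt (a n) = X" "deg (a n) = - int n"
  "arr (b n)" "src (b n) = Y" "tgt (b n) = X" "deg (b n) = - int n - 1"
  "arr (c n)" "src (c n) = X" "tgt (c n) = Y" "deg (c n) = 1 - int n"
  "arr (d n)" "src (d n) = Y" "tgt (d n) = Y" "deg (d n) = - int n"
  using column_steps[of X 0 "(idn X, nul X Y 1)" n] column_steps[of Y "-1" "(nul Y X (-1), idn Y)" n]
  by (auto simp: a_def b_def c_def d_def column_def X_obj Y_obj)

lemma entries_0 [simp]: "a 0 = idn X" "b 0 = nul Y X (-1)" "c 0 = nul X Y 1" "d 0 = idn Y"
  by (simp_all add: a_def b_def c_def d_def)

lemma entries_Suc:
  "a (Suc n) = h \<cdot> a n \<boxplus> w \<cdot> c n" "c (Suc n) = f \<cdot> a n \<boxplus> neg (k \<cdot> c n)"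
  "b (Suc n) = h \<cdot> b n \<boxplus> w \<cdot> d n" "d (Suc n) = f \<cdot> b n \<boxplus> neg (k \<cdot> d n)"
  by (simp_all add: a_def b_def c_def d_def step_def)

text \<open>\<open>step\<close> commutes with composition on the right, so its iterates are
  determined by the images of the two unit columns.\<close>

lemma steps_eq:
  assumes "column A m (x, y)"
  shows "(step ^^ n) (x, y) = (a n \<cdot> x \<boxplus> b n \<cdot> y, c n \<cdot> x \<boxplus> d n \<cdot> y)"
proof (induction n)
  case 0
  then show ?case using assms by (simp add: column_def typing)
next
  case (Suc n)
  then show ?case
    using assms
    by (simp add: step_def column_def typing entries_Suc cmp_plus plus_cmp cmp_assoc plus_ac)
qed

text \<open>These are the four entries of s^(m+n) = s^m s^n.\<close>

lemma entries_add:
  "a (m + n) = a m \<cdot> a n \<boxplus> b m \<cdot> c n" "c (m + n) = c m \<cdot> a n \<boxplus> d m \<cdot> c n"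
  "b (m + n) = a m \<cdot> b n \<boxplus> b m \<cdot> d n" "d (m + n) = c m \<cdot> b n \<boxplus> d m \<cdot> d n"
proof -
  have "(step ^^ (m + n)) (idn X, nul X Y 1) = (step ^^ m) (a n, c n)"
    "(step ^^ (m + n)) (nul Y X (-1), idn Y) = (step ^^ m) (b n, d n)"
    by (simp_all add: funpow_add a_def b_def c_def d_def)
  moreover have "column X (- int n) (a n, c n)" "column Y (- int n - 1) (b n, d n)"
    by (simp_all add: column_def)
  ultimately show
    "a (m + n) = a m \<cdot> a n \<boxplus> b m \<cdot> c n" "c (m + n) = c m \<cdot> a n \<boxplus> d m \<cdot> c n"
    "b (m + n) = a m \<cdot> b n \<boxplus> b m \<cdot> d n" "d (m + n) = c m \<cdot> b n \<boxplus> d m \<cdot> d n"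
    by (simp_all add: steps_eq a_def[of "m + n"] b_def[of "m + n"] c_def[of "m + n"] d_def[of "m + n"])
qed

text \<open>
  With \<open>\<delta>(x, y) = (dx + gy, -dy)\<close> for the differential of the cone, the following lemma says
  \<open>\<delta>(s v) = v - s (\<delta> v)\<close>.  In \<open>D\<close> there is also the composition with \<open>g\<close> on the right; it accounts
  for the terms \<open>a n \<cdot> g\<close> and \<open>c n \<cdot> g\<close> in the formulas for \<open>b\<close> and \<open>d\<close> below.
\<close>

lemma dif_step:
  assumes "column A m (x, y)" "column A (m + 1) (u, v)"
    and "dif x = u \<boxplus> neg (g \<cdot> y)" "dif y = neg v"
    and "step (x, y) = (x', y')" "step (u, v) = (u', v')"
  shows "dif x' = (x \<boxplus> neg u') \<boxplus> neg (g \<cdot> y')" "dif y' = neg (y \<boxplus> neg v')"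
proof -
  have T: "arr x" "src x = A" "tgt x = X" "deg x = m" "arr y" "src y = A" "tgt y = Y" "deg y = m + 1"
    "arr u" "src u = A" "tgt u = X" "deg u = m + 1" "arr v" "src v = A" "tgt v = Y" "deg v = m + 2"
    using assms(1,2) by (simp_all add: column_def)
  have A: "A \<in> Ob C" using T(1,2) arr_obj by blast
  have S: "x' = h \<cdot> x \<boxplus> w \<cdot> y" "y' = f \<cdot> x \<boxplus> neg (k \<cdot> y)"
    "u' = h \<cdot> u \<boxplus> w \<cdot> v" "v' = f \<cdot> u \<boxplus> neg (k \<cdot> v)"
    using assms(5,6) by (simp_all add: step_def)
  note laws = T A S assms(3,4) typing dif_plus dif_cmp dif_f dif_g dif_h dif_k dif_w cmp_plus plus_cmp
    cmp_assoc plus_ac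
  \<comment> \<open>The term \<open>h \<cdot> g \<cdot> y\<close> arises once from d(x) and once,
    with the opposite sign, from d(w). Both copies stay visible, with cancellation switched off, so
    that the two sides have the same summands up to order.\<close>
  have "dif x' = ((x \<boxplus> neg u') \<boxplus> neg (g \<cdot> y')) \<boxplus> (h \<cdot> g \<cdot> y \<boxplus> neg (h \<cdot> g \<cdot> y))"
    by (simp add: laws del: plus_neg plus_neg_cancel)
  then show "dif x' = (x \<boxplus> neg u') \<boxplus> neg (g \<cdot> y')" by (simp add: T A S typing)
  have "dif y' = neg (y \<boxplus> neg v') \<boxplus> (f \<cdot> g \<cdot> y \<boxplus> neg (f \<cdot> g \<cdot> y))"
    by (simp add: laws del: plus_neg plus_neg_cancel)
  then show "dif y' = neg (y \<boxplus> neg v')" by (simp add: T A S typing)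
qed

text \<open>As s is odd, D(s^(n+1)) = s^n - s D(s^n). Hence D(s^n) alternates between 0 for even n
  and s^(n-1) for odd n; solving its entries for d gives these formulas. The parity test also keeps
  \<open>n - 1\<close> away from n = 0.\<close>

lemma dif_entries:
  "dif (a n) = (if even n then nul X X (1 - int n) else a (n - 1)) \<boxplus> neg (g \<cdot> c n)"
  "dif (c n) = neg (if even n then nul X Y (2 - int n) else c (n - 1))"
  "dif (b n) = (if even n then a n \<cdot> g else b (n - 1) \<boxplus> neg (a n \<cdot> g)) \<boxplus> neg (g \<cdot> d n)"
  "dif (d n) = neg (if even n then c n \<cdot> g else d (n - 1) \<boxplus> neg (c n \<cdot> g))"
proof -
  \<comment> \<open>The pairs (\<open>ux n\<close>, \<open>vx n\<close>) and (\<open>uy n\<close>,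
    \<open>vy n\<close>) are the expected values of \<delta> on the two columns of s^n.\<close>
  define ux vx uy vy where
    "ux n = (if even n then nul X X (1 - int n) else a (n - 1))" and
    "vx n = (if even n then nul X Y (2 - int n) else c (n - 1))" and
    "uy n = (if even n then a n \<cdot> g else b (n - 1) \<boxplus> neg (a n \<cdot> g))" and
    "vy n = (if even n then c n \<cdot> g else d (n - 1) \<boxplus> neg (c n \<cdot> g))" for n
  note defs = ux_def vx_def uy_def vy_def
  have pred: "int (n - Suc 0) = int n - 1" if "odd n" for n :: nat
    using that by (cases n) auto
  have "dif (a n) = ux n \<boxplus> neg (g \<cdot> c n) \<and> dif (c n) = neg (vx n) \<and>
        dif (b n) = uy n \<boxplus> neg (g \<cdot> d n) \<and> dif (d n) = neg (vy n)"
  proof (induction n)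
    case 0
    then show ?case by (simp add: defs typing)
  next
    case (Suc n)
    have cols: "column X (- int n) (a n, c n)" "column X (- int n + 1) (ux n, vx n)"
      "column Y (- int n - 1) (b n, d n)" "column Y (- int n - 1 + 1) (uy n, vy n)"
      by (simp_all add: column_def defs typing pred)
    have steps: "step (a n, c n) = (a (Suc n), c (Suc n))" "step (b n, d n) = (b (Suc n), d (Suc n))"
      by (simp_all add: step_def entries_Suc)
    \<comment> \<open>This is s \<delta>(v) = v - \<delta>(s v) for the first column v of s^n,
      checked on the expected values for each parity.\<close>
    have "step (ux n, vx n) = (a n \<boxplus> neg (ux (Suc n)), c n \<boxplus> neg (vx (Suc n)))"
      using entries_Suc(1,2)[of "n - 1"] by (simp add: step_def defs typing flip: entries_Suc)
    from dif_step[OF cols(1,2) _ _ steps(1) this] Suc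
    have 1: "dif (a (Suc n)) = (a n \<boxplus> neg (a n \<boxplus> neg (ux (Suc n)))) \<boxplus> neg (g \<cdot> c (Suc n))"
      "dif (c (Suc n)) = neg (c n \<boxplus> neg (c n \<boxplus> neg (vx (Suc n))))" by blast+
    have right_g: "a (Suc n) \<cdot> g = h \<cdot> a n \<cdot> g \<boxplus> w \<cdot> c n \<cdot> g"
      "c (Suc n) \<cdot> g = f \<cdot> a n \<cdot> g \<boxplus> neg (k \<cdot> c n \<cdot> g)"
      by (simp_all add: entries_Suc typing plus_cmp cmp_assoc)
    have "step (uy n, vy n) = (b n \<boxplus> neg (uy (Suc n)), d n \<boxplus> neg (vy (Suc n)))"
    proof (cases "even n")
      case True
      then show ?thesis by (simp add: step_def defs typing right_g)
    next
      case False
      then have "b n = h \<cdot> b (n - 1) \<boxplus> w \<cdot> d (n - 1)" "d n = f \<cdot> b (n - 1) \<boxplus> neg (k \<cdot> d (n - 1))"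
        using entries_Suc(3,4)[of "n - 1"] by simp_all
      with False show ?thesis by (simp add: step_def defs typing right_g pred cmp_plus plus_ac)
    qed
    from dif_step[OF cols(3,4) _ _ steps(2) this] Suc
    have 2: "dif (b (Suc n)) = (b n \<boxplus> neg (b n \<boxplus> neg (uy (Suc n)))) \<boxplus> neg (g \<cdot> d (Suc n))"
      "dif (d (Suc n)) = neg (d n \<boxplus> neg (d n \<boxplus> neg (vy (Suc n))))" by blast+
    show ?case
      using 1 2 by (simp add: defs typing)
  qed
  then show
    "dif (a n) = (if even n then nul X X (1 - int n) else a (n - 1)) \<boxplus> neg (g \<cdot> c n)"
    "dif (c n) = neg (if even n then nul X Y (2 - int n) else c (n - 1))"
    "dif (b n) = (if even n then a n \<cdot> g else b (n - 1) \<boxplus> neg (a n \<cdot> g)) \<boxplus> neg (g \<cdot> d n)"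
    "dif (d n) = neg (if even n then c n \<cdot> g else d (n - 1) \<boxplus> neg (c n \<cdot> g))"
    unfolding defs by blast+
qed

lemma entries_in_hom:
  "in_hom X Y (0 - 2 * int i) (c (2 * i + 1))"
  "in_hom Y X (-2 - 2 * int i) (b (2 * i + 1))"
  "in_hom X X (-1 - 2 * int i) (a (2 * i + 1))"
  "in_hom Y Y (-1 - 2 * int i) (neg (d (2 * i + 1)))"
  by (simp_all add: in_hom_def)

section \<open>The strong homotopy equivalence\<close>

text \<open>The matrix S has rows (\<epsilon>H, \<epsilon>B) and (\<epsilon>F, -\<epsilon>K); the
  sign in \<open>K\<close> matches the entry -k of s.\<close>

definition "F = series (\<lambda>i. c (2 * i + 1))"
definition "B = series (\<lambda>i. b (2 * i + 1))"
definition "G = case_nat (val g) B"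
definition "H = series (\<lambda>i. a (2 * i + 1))"
definition "K = series (\<lambda>i. neg (d (2 * i + 1)))"

lemma g_Arrow: "Arrow Y X 0 (val g) = g" "val g \<in> carrier (Hom C Y X 0)"
  using g_arr by (cases g; auto simp: arr_def)+

lemma series_typing:
  "F \<in> carrier (Hom (eps_category C) X Y 0)"
  "B \<in> carrier (Hom (eps_category C) Y X (0 - 2))"
  "G \<in> carrier (Hom (eps_category C) Y X 0)"
  "H \<in> carrier (Hom (eps_category C) X X (-1))"
  "K \<in> carrier (Hom (eps_category C) Y Y (-1))"
proof -
  show B: "B \<in> carrier (Hom (eps_category C) Y X (0 - 2))"
    unfolding B_def using series_closed[OF entries_in_hom(2)] X_obj Y_obj by simp
  show "G \<in> carrier (Hom (eps_category C) Y X 0)"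
    unfolding G_def using g_Arrow(2) B by (rule case_nat_closed)
qed (unfold F_def H_def K_def, (intro series_closed entries_in_hom X_obj Y_obj)+)

lemma coef_F: "coef X Y 0 F i = scl (signed_catalan i) (c (2 * i + 1))"
  and coef_H: "coef X X (-1) H i = scl (signed_catalan i) (a (2 * i + 1))"
  and coef_K: "coef Y Y (-1) K i = scl (signed_catalan i) (neg (d (2 * i + 1)))"
  and coef_B: "coef Y X (-2) B i = scl (signed_catalan i) (b (2 * i + 1))"
  unfolding F_def H_def K_def B_def by (rule coef_series, rule entries_in_hom)+

lemma coef_G: "coef Y X 0 G i = (case i of 0 \<Rightarrow> g | Suc j \<Rightarrow> scl (signed_catalan j) (b (2 * j + 1)))"
  using coef_B g_Arrow by (simp add: coef_def G_def algebra_simps split: nat.split)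

section \<open>The four structure equations, one matrix entry each\<close>

lemma index_sum: "j \<le> p \<Longrightarrow> (2 * j + 1) + (2 * (p - j) + 1) = 2 * p + 2" for j p :: nat
  by simp

text \<open>Second row, first column of D S + S^2 = \<epsilon>; the sign in \<open>K\<close> turns
  the difference FH - KF into an entry of S^2, up to powers of \<epsilon>.\<close>

lemma Diff_F:
  "Diff (eps_category C) X Y 0 F =
    eps_mult C X Y (-1)
      (Comp (eps_category C) X X Y 0 (-1) F H \<ominus>\<^bsub>Hom (eps_category C) X Y (-1)\<^esub>
       Comp (eps_category C) X Y Y (-1) 0 K F)" (is "?L = eps_mult C X Y (-1) ?R")
proof (rule series_eqI)
  fix i
  have "coef X Y 1 ?L i = dif (coef X Y 0 F i)"
    using coef_Diff[of X Y 0 F i] by simp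
  also have "\<dots> = (case i of 0 \<Rightarrow> nul X Y 1 | Suc j \<Rightarrow> coef X Y (-1) ?R j)"
  proof (cases i)
    case 0
    then show ?thesis by (simp add: coef_F dif_entries typing)
  next
    case (Suc p)
    have "coef X Y (-1) ?R p = coef X Y (-1) (Comp (eps_category C) X X Y 0 (-1) F H) p \<boxplus>
        neg (coef X Y (-1) (Comp (eps_category C) X Y Y (-1) 0 K F) p)"
      using eps_Comp_closed[of X X Y F 0 H "-1"] eps_Comp_closed[of X Y Y K "-1" F 0] series_typing
      by (intro coef_minus) (simp_all add: typing)
    also have "\<dots> = neg (scl (signed_catalan (Suc p)) (c (2 * p + 2)))"
    proof (unfold F_def H_def K_def, rule coef_Comp_series_sum(2)[OF _ _ _ _ entries_in_hom(1,3,4,1)])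
      fix j assume "j \<le> p"
      then show "c (2 * j + 1) \<cdot> a (2 * (p - j) + 1) \<boxplus>
          neg (neg (d (2 * j + 1)) \<cdot> c (2 * (p - j) + 1)) = c (2 * p + 2)"
        using entries_add(2)[of "2 * j + 1" "2 * (p - j) + 1"] index_sum[of j p] by simp
    qed (simp_all add: typing)
    \<comment> \<open>With i = p + 1 the exponent 2i + 1 = 2p + 3 is odd, so d sends
      \<open>c (2 * p + 3)\<close> to the negative of \<open>c (2 * p + 2)\<close>.\<close>
    also have "\<dots> = dif (coef X Y 0 F i)"
      by (simp add: Suc coef_F dif_entries)
    finally show ?thesis using Suc by simp
  qed
  also have "\<dots> = coef X Y 1 (eps_mult C X Y (-1) ?R) i"
    using coef_eps_mult[of X Y "-1" ?R i] by (simp split: nat.split)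
  finally show "coef X Y 1 ?L i = coef X Y 1 (eps_mult C X Y (-1) ?R) i" .
qed

text \<open>First row, second column. The constant term g of G enters both composites and produces
  the terms with g in the formula for d of \<open>b\<close>.\<close>

lemma Diff_G:
  "Diff (eps_category C) Y X 0 G =
    eps_mult C Y X (-1)
      (Comp (eps_category C) Y Y X 0 (-1) G K \<ominus>\<^bsub>Hom (eps_category C) Y X (-1)\<^esub>
       Comp (eps_category C) Y X X (-1) 0 H G)" (is "?L = eps_mult C Y X (-1) ?R")
proof (rule series_eqI)
  let ?S = "Comp (eps_category C) Y Y X 0 (-1) G K" and ?T = "Comp (eps_category C) Y X X (-1) 0 H G"
  let ?S' = "Comp (eps_category C) Y Y X (0 - 2) (-1) B K"
    and ?T' = "Comp (eps_category C) Y X X (-1) (0 - 2) H B"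
  fix i
  have "coef Y X 1 ?L i = dif (coef Y X 0 G i)"
    using coef_Diff[of Y X 0 G i] by simp
  also have "\<dots> = (case i of 0 \<Rightarrow> nul Y X 1 | Suc j \<Rightarrow> coef Y X (-1) ?R j)"
  proof (cases i)
    case 0
    then show ?thesis by (simp add: coef_G dif_g)
  next
    case (Suc p)
    have R: "coef Y X (-1) ?R p = coef Y X (-1) ?S p \<boxplus> neg (coef Y X (-1) ?T p)"
      using eps_Comp_closed[of Y Y X G 0 K "-1"] eps_Comp_closed[of Y X X H "-1" G 0] series_typing
      by (intro coef_minus) (simp_all add: typing)
    also have "\<dots> = dif (coef Y X 0 G i)"
    proof (cases p)
      case 0
      \<comment> \<open>At this order \<epsilon>B does not contribute yet, and \<open>b 0\<close>
        vanishes.\<close>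
      have "coef Y X (-1) ?S 0 = g \<cdot> neg (d 1)" "coef Y X (-1) ?T 0 = a 1 \<cdot> g"
        using coef_Comp_0[of Y Y X G 0 K "-1"] coef_Comp_0[of Y X X H "-1" G 0] series_typing
        by (simp_all add: typing coef_G coef_H coef_K)
      then show ?thesis
        by (simp add: 0 Suc coef_G dif_entries typing plus_ac)
    next
      case (Suc r)
      have arrs: "arr (coef Y X (-3) ?S' r)" "arr (coef Y X (-3) ?T' r)"
        using eps_Comp_closed[of Y Y X B "0 - 2" K "-1"] eps_Comp_closed[of Y X X H "-1" B "0 - 2"]
          series_typing eps_carrier_iff[of Y X _ "-3"] by (simp_all add: typing)
      \<comment> \<open>The entry of s^(2r+2) appears negated, since \<open>K\<close> carries -d and
        the second composite is subtracted.\<close>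
      have "coef Y X (-3) ?S' r \<boxplus> neg (coef Y X (-3) ?T' r) =
          neg (scl (signed_catalan (Suc r)) (neg (b (2 * r + 2))))"
      proof (unfold B_def H_def K_def,
          rule coef_Comp_series_sum(2)[OF _ _ _ _ _ entries_in_hom(4) entries_in_hom(3)])
        fix j assume "j \<le> r"
        then show "b (2 * j + 1) \<cdot> neg (d (2 * (r - j) + 1)) \<boxplus>
            neg (a (2 * j + 1) \<cdot> b (2 * (r - j) + 1)) = neg (b (2 * r + 2))"
          using entries_add(3)[of "2 * j + 1" "2 * (r - j) + 1"] index_sum[of j r]
          by (simp add: plus_ac)
      qed (use entries_in_hom in \<open>simp_all add: typing\<close>)
      then have sum: "coef Y X (-3) ?S' r \<boxplus> neg (coef Y X (-3) ?T' r) =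
          scl (signed_catalan (Suc r)) (b (2 * r + 2))" by simp
      have S: "coef Y X (-1) ?S p = coef Y X (-3) ?S' r \<boxplus> g \<cdot> coef Y Y (-1) K p"
        using coef_Comp_case_nat_left[of Y Y X "val g" 0 B K "-1" r] series_typing g_Arrow Suc
        by (simp add: G_def typing)
      have T: "coef Y X (-1) ?T p = coef X X (-1) H p \<cdot> g \<boxplus> coef Y X (-3) ?T' r"
        using coef_Comp_case_nat_right[of Y X X H "-1" "val g" 0 B r] series_typing g_Arrow Suc
        by (simp add: G_def typing)
      \<comment> \<open>Regrouping separates the products with B, which give the Catalan term, from
        those with g.\<close>
      have "coef Y X (-1) ?S p \<boxplus> neg (coef Y X (-1) ?T p) =
          (coef Y X (-3) ?S' r \<boxplus> neg (coef Y X (-3) ?T' r)) \<boxplus>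
          (g \<cdot> coef Y Y (-1) K p \<boxplus> neg (coef X X (-1) H p \<cdot> g))"
        unfolding S T coef_K coef_H using arrs by (simp add: typing Suc plus_ac)
      also have "\<dots> = dif (coef Y X 0 G i)"
        unfolding sum coef_K coef_H
        by (simp add: Suc \<open>i = Suc p\<close> coef_G dif_entries typing scl_plus plus_ac)
      finally show ?thesis .
    qed
    finally show ?thesis using Suc by simp
  qed
  also have "\<dots> = coef Y X 1 (eps_mult C Y X (-1) ?R) i"
    using coef_eps_mult[of Y X "-1" ?R i] by (simp split: nat.split)
  finally show "coef Y X 1 ?L i = coef Y X 1 (eps_mult C Y X (-1) ?R) i" .
qed

text \<open>First row, first column. The right-hand side \<epsilon> of the matrix equation, divided
  by \<epsilon>, is the identity at \<epsilon>^0; it comes from \<open>a 0\<close>.\<close>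

lemma Diff_H:
  "Diff (eps_category C) X X (-1) H =
    Ident (eps_category C) X \<ominus>\<^bsub>Hom (eps_category C) X X 0\<^esub>
      Comp (eps_category C) X Y X 0 0 G F \<ominus>\<^bsub>Hom (eps_category C) X X 0\<^esub>
      eps_mult C X X (-2) (Comp (eps_category C) X X X (-1) (-1) H H)" (is "?L = ?R")
proof (rule series_eqI)
  let ?S = "Comp (eps_category C) X Y X 0 0 G F" and ?T = "Comp (eps_category C) X X X (-1) (-1) H H"
  let ?S' = "Comp (eps_category C) X Y X (0 - 2) 0 B F"
  have closed: "?S \<in> carrier (Hom (eps_category C) X X 0)"
    "?S' \<in> carrier (Hom (eps_category C) X X (-2))" "?T \<in> carrier (Hom (eps_category C) X X (-2))"
    using eps_Comp_closed[of X Y X G 0 F 0] eps_Comp_closed[of X Y X B "0 - 2" F 0]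
      eps_Comp_closed[of X X X H "-1" H "-1"] series_typing by (simp_all add: typing)
  fix i
  have "coef X X 0 ?L i = dif (coef X X (-1) H i)"
    using coef_Diff[of X X "-1" H i] by simp
  also have "\<dots> = (case i of 0 \<Rightarrow> idn X \<boxplus> neg (coef X X 0 ?S 0)
      | Suc p \<Rightarrow> neg (coef X X 0 ?S (Suc p) \<boxplus> coef X X (-2) ?T p))"
  proof (cases i)
    case 0
    have "coef X X 0 ?S 0 = g \<cdot> c 1"
      using coef_Comp_0[of X Y X G 0 F 0] series_typing by (simp add: typing coef_G coef_F)
    then show ?thesis
      by (simp add: 0 coef_H dif_entries typing)
  next
    case (Suc p)
    have arrs: "arr (coef X X (-2) ?S' p)" "arr (coef X X (-2) ?T p)"
      using closed by (simp_all add: eps_carrier_iff typing)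
    have sum: "coef X X (-2) ?S' p \<boxplus> coef X X (-2) ?T p = neg (scl (signed_catalan (Suc p)) (a (2 * p + 2)))"
    proof (unfold B_def F_def H_def, rule coef_Comp_series_sum(1)[OF _ _ _ _ _ entries_in_hom(1,3,3)])
      fix j assume "j \<le> p"
      then show "b (2 * j + 1) \<cdot> c (2 * (p - j) + 1) \<boxplus> a (2 * j + 1) \<cdot> a (2 * (p - j) + 1) =
          a (2 * p + 2)"
        using entries_add(1)[of "2 * j + 1" "2 * (p - j) + 1"] index_sum[of j p]
        by (simp add: plus_commute)
    qed (use entries_in_hom in \<open>simp_all add: typing\<close>)
    have S: "coef X X 0 ?S (Suc p) = coef X X (-2) ?S' p \<boxplus> g \<cdot> coef X Y 0 F (Suc p)"
      using coef_Comp_case_nat_left[of X Y X "val g" 0 B F 0 p] series_typing g_Arrow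
      by (simp add: G_def typing)
    have "coef X X 0 ?S (Suc p) \<boxplus> coef X X (-2) ?T p =
        (coef X X (-2) ?S' p \<boxplus> coef X X (-2) ?T p) \<boxplus> g \<cdot> coef X Y 0 F (Suc p)"
      unfolding S coef_F using arrs by (simp add: typing plus_ac)
    then have "coef X X 0 ?S (Suc p) \<boxplus> coef X X (-2) ?T p =
        neg (scl (signed_catalan (Suc p)) (a (2 * p + 2))) \<boxplus> g \<cdot> coef X Y 0 F (Suc p)"
      unfolding sum .
    then show ?thesis
      by (simp add: Suc coef_H coef_F dif_entries typing scl_plus)
  qed
  also have "\<dots> = coef X X 0 ?R i"
    using coef_Ident_minus[OF X_obj closed(1,3)] by simp
  finally show "coef X X 0 ?L i = coef X X 0 ?R i" .
qed

text \<open>Second row, second column. Here g is composed on the right of F, and the two signs in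
  the square of \<open>K\<close> cancel.\<close>

lemma Diff_K:
  "Diff (eps_category C) Y Y (-1) K =
    Ident (eps_category C) Y \<ominus>\<^bsub>Hom (eps_category C) Y Y 0\<^esub>
      Comp (eps_category C) Y X Y 0 0 F G \<ominus>\<^bsub>Hom (eps_category C) Y Y 0\<^esub>
      eps_mult C Y Y (-2) (Comp (eps_category C) Y Y Y (-1) (-1) K K)" (is "?L = ?R")
proof (rule series_eqI)
  let ?S = "Comp (eps_category C) Y X Y 0 0 F G" and ?T = "Comp (eps_category C) Y Y Y (-1) (-1) K K"
  let ?S' = "Comp (eps_category C) Y X Y 0 (0 - 2) F B"
  have closed: "?S \<in> carrier (Hom (eps_category C) Y Y 0)"
    "?S' \<in> carrier (Hom (eps_category C) Y Y (-2))" "?T \<in> carrier (Hom (eps_category C) Y Y (-2))"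
    using eps_Comp_closed[of Y X Y F 0 G 0] eps_Comp_closed[of Y X Y F 0 B "0 - 2"]
      eps_Comp_closed[of Y Y Y K "-1" K "-1"] series_typing by (simp_all add: typing)
  fix i
  have "coef Y Y 0 ?L i = dif (coef Y Y (-1) K i)"
    using coef_Diff[of Y Y "-1" K i] by simp
  also have "\<dots> = (case i of 0 \<Rightarrow> idn Y \<boxplus> neg (coef Y Y 0 ?S 0)
      | Suc p \<Rightarrow> neg (coef Y Y 0 ?S (Suc p) \<boxplus> coef Y Y (-2) ?T p))"
  proof (cases i)
    case 0
    have "coef Y Y 0 ?S 0 = c 1 \<cdot> g"
      using coef_Comp_0[of Y X Y F 0 G 0] series_typing by (simp add: typing coef_G coef_F)
    then show ?thesis
      by (simp add: 0 coef_K dif_entries typing)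
  next
    case (Suc p)
    have arrs: "arr (coef Y Y (-2) ?S' p)" "arr (coef Y Y (-2) ?T p)"
      using closed by (simp_all add: eps_carrier_iff typing)
    have sum: "coef Y Y (-2) ?S' p \<boxplus> coef Y Y (-2) ?T p = neg (scl (signed_catalan (Suc p)) (d (2 * p + 2)))"
    proof (unfold B_def F_def K_def,
        rule coef_Comp_series_sum(1)[OF _ _ _ _ entries_in_hom(1) _ entries_in_hom(4,4)])
      fix j assume "j \<le> p"
      then show "c (2 * j + 1) \<cdot> b (2 * (p - j) + 1) \<boxplus>
          neg (d (2 * j + 1)) \<cdot> neg (d (2 * (p - j) + 1)) = d (2 * p + 2)"
        using entries_add(4)[of "2 * j + 1" "2 * (p - j) + 1"] index_sum[of j p] by simp
    qed (use entries_in_hom in \<open>simp_all add: typing\<close>)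
    have S: "coef Y Y 0 ?S (Suc p) = coef X Y 0 F (Suc p) \<cdot> g \<boxplus> coef Y Y (-2) ?S' p"
      using coef_Comp_case_nat_right[of Y X Y F 0 "val g" 0 B p] series_typing g_Arrow
      by (simp add: G_def typing)
    have "coef Y Y 0 ?S (Suc p) \<boxplus> coef Y Y (-2) ?T p =
        (coef Y Y (-2) ?S' p \<boxplus> coef Y Y (-2) ?T p) \<boxplus> coef X Y 0 F (Suc p) \<cdot> g"
      unfolding S coef_F using arrs by (simp add: typing plus_ac)
    then have "coef Y Y 0 ?S (Suc p) \<boxplus> coef Y Y (-2) ?T p =
        neg (scl (signed_catalan (Suc p)) (d (2 * p + 2))) \<boxplus> coef X Y 0 F (Suc p) \<cdot> g"
      unfolding sum .
    then show ?thesis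
      by (simp add: Suc coef_K coef_F dif_entries typing scl_plus)
  qed
  also have "\<dots> = coef Y Y 0 ?R i"
    using coef_Ident_minus[OF Y_obj closed(1,3)] by simp
  finally show "coef Y Y 0 ?L i = coef Y Y 0 ?R i" .
qed

lemma series_0: "F 0 = val f" "G 0 = val g" "H 0 = val h" "K 0 = val k"
proof -
  have "a 1 = h" "c 1 = f" "neg (d 1) = k"
    using entries_Suc(1,2,4)[of 0] by (simp_all add: typing)
  then show "F 0 = val f" "G 0 = val g" "H 0 = val h" "K 0 = val k"
    by (simp_all add: F_def G_def H_def K_def series_def typing)
qed

theorem strong_homotopy_equivalence_series: "strong_homotopy_equivalence C X Y F G H K"
  unfolding strong_homotopy_equivalence_def Let_def
  by (intro conjI series_typing Diff_F Diff_G Diff_H Diff_K)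

end

section \<open>From a homotopy equivalence to a contraction of the cone\<close>

theorem proposition3p10:
  fixes R :: "('k, 'r) ring_scheme"
    and C :: "('o, 'k, 'm) dgcat"
    and X Y :: 'o
    and f\<^sub>0 g\<^sub>0 h\<^sub>0 k\<^sub>0 :: 'm
  assumes "dg_category R C"
    and "X \<in> Ob C" and "Y \<in> Ob C"
    and "homotopy_equivalence C X Y f\<^sub>0 g\<^sub>0 h\<^sub>0 k\<^sub>0"
  shows "\<exists>f g h k. strong_homotopy_equivalence C X Y f g h k \<and>
           f 0 = f\<^sub>0 \<and> g 0 = g\<^sub>0 \<and> (h 0 = h\<^sub>0 \<or> k 0 = k\<^sub>0)"
proof -
  interpret dg_category R C by fact
  define f g h k where "f = Arrow X Y 0 f\<^sub>0" and "g = Arrow Y X 0 g\<^sub>0"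
    and "h = Arrow X X (-1) h\<^sub>0" and "k = Arrow Y Y (-1) k\<^sub>0"
  note arrows = f_def g_def h_def k_def
  have typing: "arr f" "src f = X" "tgt f = Y" "deg f = 0" "arr g" "src g = Y" "tgt g = X" "deg g = 0"
    "arr h" "src h = X" "tgt h = X" "deg h = -1" "arr k" "src k = Y" "tgt k = Y" "deg k = -1"
    "X \<in> Ob C" "Y \<in> Ob C"
    using assms(2-4) by (simp_all add: homotopy_equivalence_def arr_def arrows)
  have difs: "dif f = nul X Y 1" "dif g = nul Y X 1" "dif h = idn X \<boxplus> neg (g \<cdot> f)"
    "dif k = idn Y \<boxplus> neg (f \<cdot> g)"
    using assms(4)
    by (simp_all add: homotopy_equivalence_def dif_def nul_def idn_def plus_def neg_def cmp_def
        a_minus_def arrows)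
  define z where "z = g \<cdot> k \<boxplus> neg (h \<cdot> g)"
  have z: "arr z" "src z = Y" "tgt z = X" "deg z = -1"
    by (simp_all add: z_def typing)
  \<comment> \<open>Both g d(k) and d(h) g equal g - gfg.\<close>
  have dif_z: "dif z = nul Y X 0"
    by (simp add: z_def typing dif_plus dif_cmp difs cmp_plus plus_cmp cmp_assoc plus_ac)
  \<comment> \<open>The class of \<open>gk - hg\<close> is the obstruction to the first order term of \<open>g(\<epsilon>)\<close>;
    subtracting \<open>f(gk - hg)\<close> from \<open>k\<close> kills it.\<close>
  interpret cone_contraction R C X Y f g h "k \<boxplus> neg (f \<cdot> z)" "h \<cdot> z"
    \<comment> \<open>As z is closed, so is fz, and k - fz has the same differential as k. The
      witness w = hz works because d(hz) = z - gfz = g(k - fz) - hg.\<close>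
    by unfold_locales
      (simp_all add: typing z dif_plus dif_cmp difs dif_z plus_cmp cmp_plus cmp_assoc,
        simp add: z_def typing cmp_plus plus_ac)
  show ?thesis
    \<comment> \<open>Only k was modified, so the disjunct for h holds.\<close>
    using strong_homotopy_equivalence_series series_0 by (auto simp: arrows)
qed

end
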